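(* Let $R$ be a discrete valuation ring with field of fractions of characteristic $0$ and residue field $F$ of characteristic $2$. Let $X$ be the $\mathrm{Sym}(4)$-set $\mathrm{Sym}(4)/\mathrm{Sym}(2,2)$, where $\mathrm{Sym}(2,2)\cong\mathrm{Sym}(2)\times\mathrm{Sym}(2)$ is the Young subgroup. Then $X$ does not have the base change property from $R$ to $F$ on annihilators, i.e. the natural map $F\otimes_R\mathrm{Ann}_{R\mathrm{Sym}(4)}(RX)\to\mathrm{Ann}_{F\mathrm{Sym}(4)}(FX)$ is not an isomorphism. Moreover the Young permutation module $M(2,2)=FX$ for $F\mathrm{Sym}(4)$ does not have the double centraliser property.
   Context: For a finite group $G$, a finite $G$-set $X$ and a commutative ring $S$, $SX$ is the permutation module for the group algebra $SG$, and $\mathrm{Ann}_{SG}(SX)$ is its annihilator ideal. The natural map on annihilators is induced by the inclusion $\mathrm{Ann}_{RG}(RX)\subseteq RG$. For a ring $S$ and left $S$-module $P$, $\mathrm{DEnd}_S(P)$ is the ring of additive maps $P\to P$ commuting with all elements of $\mathrm{End}_S(P)$; $P$ has the double centraliser property if the natural map $S\to\mathrm{DEnd}_S(P)$ given by the action is surjective. *)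

theory Defs
  imports "HOL-Algebra.Ring_Divisibility" "HOL-Algebra.QuotRing" "HOL-Algebra.Module"
    "HOL-Algebra.Group_Action" "HOL-Algebra.Sym_Groups"
    "HOL-Algebra.Left_Coset" "HOL-Algebra.Free_Abelian_Groups"
begin

section \<open>Discrete valuation rings, residue fields, fields of fractions\<close>

definition ring_char :: "('a, 'm) ring_scheme \<Rightarrow> nat" where
  "ring_char R =
     (if \<exists>n>0::nat. add_pow R n \<one>\<^bsub>R\<^esub> = \<zero>\<^bsub>R\<^esub>
      then LEAST n::nat. n > 0 \<and> add_pow R n \<one>\<^bsub>R\<^esub> = \<zero>\<^bsub>R\<^esub> else 0)"

locale discrete_valuation_ring = principal_domain +
  assumes unique_maximalideal: "\<exists>!I. maximalideal I R"
    and not_field: "\<not> field R"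

definition max_ideal :: "('a, 'm) ring_scheme \<Rightarrow> 'a set" where
  "max_ideal R = (THE I. maximalideal I R)"

definition residue_field :: "('a, 'm) ring_scheme \<Rightarrow> 'a set ring" where
  "residue_field R = R Quot (max_ideal R)"

definition residue_map :: "('a, 'm) ring_scheme \<Rightarrow> 'a \<Rightarrow> 'a set" where
  "residue_map R r = max_ideal R +>\<^bsub>R\<^esub> r"

text \<open>\<open>K\<close> is a field of fractions of \<open>R\<close>, with respect to the embedding \<open>\<iota>\<close>.\<close>

definition is_fraction_field ::
    "('a, 'm) ring_scheme \<Rightarrow> ('k, 'n) ring_scheme \<Rightarrow> ('a \<Rightarrow> 'k) \<Rightarrow> bool" where
  "is_fraction_field R K \<iota> \<longleftrightarrow>
     field K \<and> \<iota> \<in> ring_hom R K \<and> inj_on \<iota> (carrier R) \<and>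
     (\<forall>x\<in>carrier K. \<exists>a\<in>carrier R. \<exists>b\<in>carrier R - {\<zero>\<^bsub>R\<^esub>}.
        x = \<iota> a \<otimes>\<^bsub>K\<^esub> inv\<^bsub>K\<^esub> (\<iota> b))"


section \<open>Left modules, annihilators, double centralisers\<close>

text \<open>The locale \<open>module\<close> of the library requires a commutative ring of scalars.\<close>

locale left_module = S?: ring S + P?: abelian_group P
    for S :: "('s, 'm) ring_scheme" (structure)
      and P :: "('s, 'p, 'n) module_scheme" (structure) +
  assumes smult_closed [simp, intro]:
      "\<lbrakk>a \<in> carrier S; x \<in> carrier P\<rbrakk> \<Longrightarrow> a \<odot>\<^bsub>P\<^esub> x \<in> carrier P"
    and smult_l_distr:
      "\<lbrakk>a \<in> carrier S; b \<in> carrier S; x \<in> carrier P\<rbrakk> \<Longrightarrow>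
       (a \<oplus>\<^bsub>S\<^esub> b) \<odot>\<^bsub>P\<^esub> x = a \<odot>\<^bsub>P\<^esub> x \<oplus>\<^bsub>P\<^esub> b \<odot>\<^bsub>P\<^esub> x"
    and smult_r_distr:
      "\<lbrakk>a \<in> carrier S; x \<in> carrier P; y \<in> carrier P\<rbrakk> \<Longrightarrow>
       a \<odot>\<^bsub>P\<^esub> (x \<oplus>\<^bsub>P\<^esub> y) = a \<odot>\<^bsub>P\<^esub> x \<oplus>\<^bsub>P\<^esub> a \<odot>\<^bsub>P\<^esub> y"
    and smult_assoc1:
      "\<lbrakk>a \<in> carrier S; b \<in> carrier S; x \<in> carrier P\<rbrakk> \<Longrightarrow>
       (a \<otimes>\<^bsub>S\<^esub> b) \<odot>\<^bsub>P\<^esub> x = a \<odot>\<^bsub>P\<^esub> (b \<odot>\<^bsub>P\<^esub> x)"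
    and smult_one [simp]: "x \<in> carrier P \<Longrightarrow> \<one>\<^bsub>S\<^esub> \<odot>\<^bsub>P\<^esub> x = x"

definition annihilator ::
    "('s, 'm) ring_scheme \<Rightarrow> ('s, 'p, 'n) module_scheme \<Rightarrow> 's set" where
  "annihilator S P = {s \<in> carrier S. \<forall>p\<in>carrier P. s \<odot>\<^bsub>P\<^esub> p = \<zero>\<^bsub>P\<^esub>}"

text \<open>
  Maps on a module are taken extensional, i.e. \<open>undefined\<close> outside the carrier, so that
  equality of maps is equality on the carrier.
\<close>

definition additive_End :: "('p, 'n) ring_scheme \<Rightarrow> ('p \<Rightarrow> 'p) set" where
  "additive_End P = hom (add_monoid P) (add_monoid P) \<inter> extensional (carrier P)"

definition module_End ::
    "('s, 'm) ring_scheme \<Rightarrow> ('s, 'p, 'n) module_scheme \<Rightarrow> ('p \<Rightarrow> 'p) set" where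
  "module_End S P = {e \<in> additive_End P.
     \<forall>s\<in>carrier S. \<forall>p\<in>carrier P. e (s \<odot>\<^bsub>P\<^esub> p) = s \<odot>\<^bsub>P\<^esub> e p}"

definition DEnd ::
    "('s, 'm) ring_scheme \<Rightarrow> ('s, 'p, 'n) module_scheme \<Rightarrow> ('p \<Rightarrow> 'p) set" where
  "DEnd S P = {d \<in> additive_End P.
     \<forall>e\<in>module_End S P. \<forall>p\<in>carrier P. d (e p) = e (d p)}"

definition natural_action ::
    "('s, 'p, 'n) module_scheme \<Rightarrow> 's \<Rightarrow> 'p \<Rightarrow> 'p" where
  "natural_action P s = (\<lambda>p\<in>carrier P. s \<odot>\<^bsub>P\<^esub> p)"

definition double_centraliser_property ::
    "('s, 'm) ring_scheme \<Rightarrow> ('s, 'p, 'n) module_scheme \<Rightarrow> bool" where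
  "double_centraliser_property S P \<longleftrightarrow> natural_action P ` carrier S = DEnd S P"


section \<open>Tensor products\<close>

definition tensor_relations ::
    "('r, 'm) ring_scheme \<Rightarrow> ('r, 'a, 'k) module_scheme \<Rightarrow> ('r, 'b, 'l) module_scheme
      \<Rightarrow> ('a \<times> 'b \<Rightarrow>\<^sub>0 int) set" where
  "tensor_relations R M N =
     {frag_of (x \<oplus>\<^bsub>M\<^esub> x', y) - frag_of (x, y) - frag_of (x', y) | x x' y.
        x \<in> carrier M \<and> x' \<in> carrier M \<and> y \<in> carrier N}
   \<union> {frag_of (x, y \<oplus>\<^bsub>N\<^esub> y') - frag_of (x, y) - frag_of (x, y') | x y y'.
        x \<in> carrier M \<and> y \<in> carrier N \<and> y' \<in> carrier N}
   \<union> {frag_of (r \<odot>\<^bsub>M\<^esub> x, y) - frag_of (x, r \<odot>\<^bsub>N\<^esub> y) | r x y.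
        r \<in> carrier R \<and> x \<in> carrier M \<and> y \<in> carrier N}"

definition tensor_kernel ::
    "('r, 'm) ring_scheme \<Rightarrow> ('r, 'a, 'k) module_scheme \<Rightarrow> ('r, 'b, 'l) module_scheme
      \<Rightarrow> ('a \<times> 'b \<Rightarrow>\<^sub>0 int) set" where
  "tensor_kernel R M N =
     generate (free_Abelian_group (carrier M \<times> carrier N)) (tensor_relations R M N)"

definition tensor_product ::
    "('r, 'm) ring_scheme \<Rightarrow> ('r, 'a, 'k) module_scheme \<Rightarrow> ('r, 'b, 'l) module_scheme
      \<Rightarrow> ('a \<times> 'b \<Rightarrow>\<^sub>0 int) set monoid" where
  "tensor_product R M N =
     free_Abelian_group (carrier M \<times> carrier N) Mod tensor_kernel R M N"

definition pure_tensor ::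
    "('r, 'm) ring_scheme \<Rightarrow> ('r, 'a, 'k) module_scheme \<Rightarrow> ('r, 'b, 'l) module_scheme
      \<Rightarrow> 'a \<Rightarrow> 'b \<Rightarrow> ('a \<times> 'b \<Rightarrow>\<^sub>0 int) set" where
  "pure_tensor R M N x y =
     tensor_kernel R M N #>\<^bsub>free_Abelian_group (carrier M \<times> carrier N)\<^esub> frag_of (x, y)"

text \<open>
  \<open>tensor_lift A b\<close> is the additive map on a tensor product with values in \<open>A\<close> which is induced
  by the balanced biadditive map \<open>b\<close>: all representatives of a class have the same value under
  the \<open>\<int>\<close>-linear extension of \<open>b\<close>.
\<close>

definition frag_eval ::
    "('c, 'n) ring_scheme \<Rightarrow> ('a \<Rightarrow> 'b \<Rightarrow> 'c) \<Rightarrow> ('a \<times> 'b \<Rightarrow>\<^sub>0 int) \<Rightarrow> 'c" where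
  "frag_eval A b c =
     (\<Oplus>\<^bsub>A\<^esub>p \<in> Poly_Mapping.keys c. add_pow A (Poly_Mapping.lookup c p) (case_prod b p))"

definition tensor_lift ::
    "('c, 'n) ring_scheme \<Rightarrow> ('a \<Rightarrow> 'b \<Rightarrow> 'c) \<Rightarrow> ('a \<times> 'b \<Rightarrow>\<^sub>0 int) set \<Rightarrow> 'c" where
  "tensor_lift A b C = the_elem (frag_eval A b ` C)"

text \<open>\<open>S\<close> as an \<open>R\<close>-module via a ring homomorphism \<open>\<phi>\<close> from \<open>R\<close> to \<open>S\<close>.\<close>

definition restrict_scalars ::
    "('s, 'n) ring_scheme \<Rightarrow> ('r \<Rightarrow> 's) \<Rightarrow> ('r, 's) module" where
  "restrict_scalars S \<phi> =
     \<lparr>carrier = carrier S, monoid.mult = monoid.mult S, one = \<one>\<^bsub>S\<^esub>,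
      ring.zero = \<zero>\<^bsub>S\<^esub>, ring.add = ring.add S, smult = (\<lambda>r s. \<phi> r \<otimes>\<^bsub>S\<^esub> s)\<rparr>"


section \<open>Group algebras and permutation modules\<close>

text \<open>
  For a finite group \<open>G\<close>; an element \<open>a\<close> stands for the formal sum of the \<open>a g \<cdot> g\<close> over
  \<open>g \<in> G\<close>.
\<close>

definition group_algebra ::
    "('s, 'm) ring_scheme \<Rightarrow> ('g, 'n) monoid_scheme \<Rightarrow> ('s, 'g \<Rightarrow> 's) module" where
  "group_algebra S G =
     \<lparr>carrier = carrier G \<rightarrow>\<^sub>E carrier S,
      monoid.mult = (\<lambda>a b. \<lambda>g\<in>carrier G.
        \<Oplus>\<^bsub>S\<^esub>h\<in>carrier G. a h \<otimes>\<^bsub>S\<^esub> b (inv\<^bsub>G\<^esub> h \<otimes>\<^bsub>G\<^esub> g)),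
      one = (\<lambda>g\<in>carrier G. if g = \<one>\<^bsub>G\<^esub> then \<one>\<^bsub>S\<^esub> else \<zero>\<^bsub>S\<^esub>),
      ring.zero = (\<lambda>g\<in>carrier G. \<zero>\<^bsub>S\<^esub>),
      ring.add = (\<lambda>a b. \<lambda>g\<in>carrier G. a g \<oplus>\<^bsub>S\<^esub> b g),
      smult = (\<lambda>s a. \<lambda>g\<in>carrier G. s \<otimes>\<^bsub>S\<^esub> a g)\<rparr>"

text \<open>
  For a finite \<open>G\<close>-set \<open>X\<close> with action \<open>\<alpha>\<close>, the left \<open>SG\<close>-module \<open>SX\<close>; an element \<open>v\<close> stands for
  the formal sum of the \<open>v x \<cdot> x\<close>, and \<open>g \<cdot> x = \<alpha> g x\<close>. A module has no ring multiplication, so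
  these fields of the record are left unspecified.
\<close>

definition perm_module ::
    "('s, 'm) ring_scheme \<Rightarrow> ('g, 'n) monoid_scheme \<Rightarrow> 'x set \<Rightarrow> ('g \<Rightarrow> 'x \<Rightarrow> 'x)
      \<Rightarrow> ('g \<Rightarrow> 's, 'x \<Rightarrow> 's) module" where
  "perm_module S G X \<alpha> =
     \<lparr>carrier = X \<rightarrow>\<^sub>E carrier S,
      monoid.mult = undefined,
      one = undefined,
      ring.zero = (\<lambda>x\<in>X. \<zero>\<^bsub>S\<^esub>),
      ring.add = (\<lambda>v w. \<lambda>x\<in>X. v x \<oplus>\<^bsub>S\<^esub> w x),
      smult = (\<lambda>a v. \<lambda>x\<in>X.
        \<Oplus>\<^bsub>S\<^esub>g\<in>carrier G. a g \<otimes>\<^bsub>S\<^esub> v (\<alpha> (inv\<^bsub>G\<^esub> g) x))\<rparr>"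

text \<open>\<open>Ann\<close> of \<open>SX\<close> in \<open>SG\<close>, with the \<open>S\<close>-module structure inherited from \<open>SG\<close>.\<close>

definition Ann_perm ::
    "('s, 'm) ring_scheme \<Rightarrow> ('g, 'n) monoid_scheme \<Rightarrow> 'x set \<Rightarrow> ('g \<Rightarrow> 'x \<Rightarrow> 'x)
      \<Rightarrow> ('s, 'g \<Rightarrow> 's) module" where
  "Ann_perm S G X \<alpha> =
     (group_algebra S G)\<lparr>carrier := annihilator (group_algebra S G) (perm_module S G X \<alpha>)\<rparr>"

text \<open>
  The map from \<open>S \<otimes> Ann(RX)\<close> to \<open>Ann(SX)\<close> induced by a ring homomorphism \<open>\<phi>\<close> from \<open>R\<close> to \<open>S\<close>:
  it sends \<open>s \<otimes> a\<close> to \<open>s\<close> times the image of \<open>a\<close> under \<open>\<phi>\<close>. Being \<open>S\<close>-linear, it is an isomorphism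
  of \<open>S\<close>-modules iff it is one of additive groups.
\<close>

definition base_change_map ::
    "('s, 'n) ring_scheme \<Rightarrow> ('r \<Rightarrow> 's) \<Rightarrow> ('g, 'k) monoid_scheme
      \<Rightarrow> 'x set \<Rightarrow> ('g \<Rightarrow> 'x \<Rightarrow> 'x) \<Rightarrow> ('s \<times> ('g \<Rightarrow> 'r) \<Rightarrow>\<^sub>0 int) set \<Rightarrow> 'g \<Rightarrow> 's" where
  "base_change_map S \<phi> G X \<alpha> =
     tensor_lift (Ann_perm S G X \<alpha>)
       (\<lambda>s a. s \<odot>\<^bsub>group_algebra S G\<^esub> (\<lambda>g\<in>carrier G. \<phi> (a g)))"

definition annihilator_base_change_property ::
    "('r, 'm) ring_scheme \<Rightarrow> ('s, 'n) ring_scheme \<Rightarrow> ('r \<Rightarrow> 's) \<Rightarrow> ('g, 'k) monoid_scheme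
      \<Rightarrow> 'x set \<Rightarrow> ('g \<Rightarrow> 'x \<Rightarrow> 'x) \<Rightarrow> bool" where
  "annihilator_base_change_property R S \<phi> G X \<alpha> \<longleftrightarrow>
     base_change_map S \<phi> G X \<alpha>
       \<in> iso (tensor_product R (restrict_scalars S \<phi>) (Ann_perm R G X \<alpha>))
             (add_monoid (Ann_perm S G X \<alpha>))"


section \<open>Coset spaces and Young subgroups\<close>

definition coset_action ::
    "('g, 'n) monoid_scheme \<Rightarrow> 'g set \<Rightarrow> 'g \<Rightarrow> 'g set \<Rightarrow> 'g set" where
  "coset_action G H g = (\<lambda>C\<in>lcosets\<^bsub>G\<^esub> H. g <#\<^bsub>G\<^esub> C)"

definition young_subgroup :: "nat \<Rightarrow> nat \<Rightarrow> (nat \<Rightarrow> nat) set" where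
  "young_subgroup a b = {p \<in> carrier (sym_group (a + b)).
     p ` {1..a} = {1..a} \<and> p ` {a+1..a+b} = {a+1..a+b}}"

section \<open>Well-definedness\<close>

lemma (in left_module) natural_action_in_DEnd:
  assumes "s \<in> carrier S"
  shows "natural_action P s \<in> DEnd S P"
proof -
  have closed: "e p \<in> carrier P" if "e \<in> module_End S P" "p \<in> carrier P" for e p
    using that by (auto simp: module_End_def additive_End_def hom_def)
  have "natural_action P s \<in> additive_End P"
    using assms by (auto simp: additive_End_def natural_action_def hom_def smult_r_distr)
  moreover have "natural_action P s (e p) = e (natural_action P s p)"
    if "e \<in> module_End S P" "p \<in> carrier P" for e p
    using assms that closed[OF that] by (simp add: natural_action_def module_End_def)
  ultimately show ?thesis by (simp add: DEnd_def)
qed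

lemma frag_eval_hom:
  assumes "abelian_group A" and b: "\<And>x y. (x, y) \<in> P \<Longrightarrow> b x y \<in> carrier A"
  shows "frag_eval A b \<in> hom (free_Abelian_group P) (add_monoid A)"
    and "(x, y) \<in> P \<Longrightarrow> frag_eval A b (frag_of (x, y)) = b x y"
proof -
  interpret abelian_group A by fact
  define m where "m = (\<lambda>c p. add_pow A (Poly_Mapping.lookup c p :: int) (case_prod b p))"
  have mem: "m c p \<in> carrier A" if "p \<in> P" for c p
    using that b by (cases p) (auto simp: m_def intro!: add.int_pow_closed)
  have eq: "frag_eval A b c = finsum A (m c) Q"
    if "Poly_Mapping.keys c \<subseteq> Q" "Q \<subseteq> P" "finite Q" for c Q
    unfolding frag_eval_def m_def[symmetric]
  proof (rule add.finprod_mono_neutral_cong_left)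
    show "m c p = \<zero>\<^bsub>A\<^esub>" if "p \<in> Q - Poly_Mapping.keys c" for p
      using that by (simp add: m_def in_keys_iff add_pow_def int_pow_def nat_pow_def)
  qed (use that mem in \<open>auto simp: m_def\<close>)
  show "frag_eval A b \<in> hom (free_Abelian_group P) (add_monoid A)"
  proof (rule homI)
    fix c d assume "c \<in> carrier (free_Abelian_group P)" "d \<in> carrier (free_Abelian_group P)"
    then have cd: "Poly_Mapping.keys c \<subseteq> P" "Poly_Mapping.keys d \<subseteq> P" by simp_all
    define Q where "Q = Poly_Mapping.keys c \<union> Poly_Mapping.keys d"
    have Q: "Q \<subseteq> P" "finite Q" "Poly_Mapping.keys c \<subseteq> Q" "Poly_Mapping.keys d \<subseteq> Q"
      "Poly_Mapping.keys (c + d) \<subseteq> Q"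
      using cd keys_add[of c d] by (auto simp: Q_def)
    have "finsum A (m (c + d)) Q = (\<Oplus>\<^bsub>A\<^esub>p\<in>Q. m c p \<oplus>\<^bsub>A\<^esub> m d p)"
    proof (rule add.finprod_cong'[OF refl])
      fix p assume "p \<in> Q"
      then have "case_prod b p \<in> carrier A" using Q(1) b by (cases p) auto
      then show "m (c + d) p = m c p \<oplus>\<^bsub>A\<^esub> m d p"
        by (simp add: m_def lookup_add add.int_pow_mult)
    qed (use Q(1) mem in auto)
    also have "\<dots> = finsum A (m c) Q \<oplus>\<^bsub>A\<^esub> finsum A (m d) Q"
      using Q(1) mem by (intro finsum_addf) auto
    finally show "frag_eval A b (c \<otimes>\<^bsub>free_Abelian_group P\<^esub> d)
        = frag_eval A b c \<otimes>\<^bsub>add_monoid A\<^esub> frag_eval A b d"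
      using Q by (simp add: eq[of _ Q])
  next
    fix c assume "c \<in> carrier (free_Abelian_group P)"
    then show "frag_eval A b c \<in> carrier (add_monoid A)"
      using mem by (auto simp: eq[of c "Poly_Mapping.keys c"] intro!: finsum_closed)
  qed
  show "frag_eval A b (frag_of (x, y)) = b x y" if "(x, y) \<in> P"
    using that b[OF that] mem[OF that] by (simp add: frag_eval_def add.int_pow_1)
qed

lemma tensor_lift:
  assumes M: "module R M" and N: "module R N" and A: "abelian_group A"
    and b: "\<And>x y. \<lbrakk>x \<in> carrier M; y \<in> carrier N\<rbrakk> \<Longrightarrow> b x y \<in> carrier A"
    and add_left: "\<And>x x' y. \<lbrakk>x \<in> carrier M; x' \<in> carrier M; y \<in> carrier N\<rbrakk>
      \<Longrightarrow> b (x \<oplus>\<^bsub>M\<^esub> x') y = b x y \<oplus>\<^bsub>A\<^esub> b x' y"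
    and add_right: "\<And>x y y'. \<lbrakk>x \<in> carrier M; y \<in> carrier N; y' \<in> carrier N\<rbrakk>
      \<Longrightarrow> b x (y \<oplus>\<^bsub>N\<^esub> y') = b x y \<oplus>\<^bsub>A\<^esub> b x y'"
    and balanced: "\<And>r x y. \<lbrakk>r \<in> carrier R; x \<in> carrier M; y \<in> carrier N\<rbrakk>
      \<Longrightarrow> b (r \<odot>\<^bsub>M\<^esub> x) y = b x (r \<odot>\<^bsub>N\<^esub> y)"
  shows "tensor_lift A b \<in> hom (tensor_product R M N) (add_monoid A)"
    and "\<lbrakk>x \<in> carrier M; y \<in> carrier N\<rbrakk> \<Longrightarrow> tensor_lift A b (pure_tensor R M N x y) = b x y"
proof -
  interpret M: module R M by fact
  interpret N: module R N by fact
  interpret A: abelian_group A by fact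
  let ?P = "carrier M \<times> carrier N"
  let ?F = "free_Abelian_group ?P" and ?K = "tensor_kernel R M N"
  interpret F: comm_group ?F by (rule abelian_free_Abelian_group)
  have hom: "frag_eval A b \<in> hom ?F (add_monoid A)"
    using b by (intro frag_eval_hom A) auto
  have of: "frag_eval A b (frag_of (x, y)) = b x y" if "x \<in> carrier M" "y \<in> carrier N" for x y
    using b that by (intro frag_eval_hom(2)[where P = ?P] A) auto
  interpret e: group_hom ?F "add_monoid A" "frag_eval A b"
    using hom by (simp add: group_hom_def group_hom_axioms_def A.a_group F.is_group)
  have diff: "frag_eval A b (c - d) = frag_eval A b c \<ominus>\<^bsub>A\<^esub> frag_eval A b d"
    if "Poly_Mapping.keys c \<subseteq> ?P" "Poly_Mapping.keys d \<subseteq> ?P" for c d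
  proof -
    have "frag_eval A b (c \<otimes>\<^bsub>?F\<^esub> inv\<^bsub>?F\<^esub> d)
        = frag_eval A b c \<otimes>\<^bsub>add_monoid A\<^esub> inv\<^bsub>add_monoid A\<^esub> frag_eval A b d"
      using that e.hom_mult[of c "inv\<^bsub>?F\<^esub> d"] e.hom_inv[of d] F.inv_closed[of d]
      by (simp only: carrier_free_Abelian_group_iff)
    then show ?thesis
      using that by (simp add: a_minus_def a_inv_def)
  qed
  have keys: "Poly_Mapping.keys (c - d) \<subseteq> ?P"
    if "Poly_Mapping.keys c \<subseteq> ?P" "Poly_Mapping.keys d \<subseteq> ?P" for c d
    using that keys_diff[of c d] by blast
  have ker: "c - d \<in> kernel ?F (add_monoid A) (frag_eval A b)"
    if "Poly_Mapping.keys c \<subseteq> ?P" "Poly_Mapping.keys d \<subseteq> ?P"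
      "frag_eval A b c = frag_eval A b d" for c d
    using that keys[OF that(1,2)] diff[OF that(1,2)] e.hom_closed[of d]
    by (simp add: kernel_def a_minus_def A.r_neg)
  have ker2: "c - d - d' \<in> kernel ?F (add_monoid A) (frag_eval A b)"
    if "Poly_Mapping.keys c \<subseteq> ?P" "Poly_Mapping.keys d \<subseteq> ?P" "Poly_Mapping.keys d' \<subseteq> ?P"
      "frag_eval A b c = frag_eval A b d \<oplus>\<^bsub>A\<^esub> frag_eval A b d'" for c d d'
    using that ker[of c "d + d'"] e.hom_mult[of d d'] keys_add[of d d']
    by (simp add: diff_diff_eq) blast
  have rel: "tensor_relations R M N \<subseteq> kernel ?F (add_monoid A) (frag_eval A b)"
    unfolding tensor_relations_def
    by (intro Un_least subsetI; clarify; (rule ker2 | rule ker))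
      (simp_all add: of add_left add_right balanced)
  have K: "subgroup ?K ?F"
    unfolding tensor_kernel_def using rel
    by (intro F.generate_is_subgroup) (auto simp: kernel_def)
  have K0: "frag_eval A b k = \<zero>\<^bsub>A\<^esub>" "k \<in> carrier ?F" if "k \<in> ?K" for k
    using F.generate_subgroup_incl[OF rel e.subgroup_kernel] that
    by (auto simp: tensor_kernel_def kernel_def)
  have lift: "tensor_lift A b (?K #>\<^bsub>?F\<^esub> c) = frag_eval A b c" if c: "c \<in> carrier ?F" for c
  proof -
    have "frag_eval A b ` (?K #>\<^bsub>?F\<^esub> c) = {frag_eval A b c}"
    proof (intro equalityI subsetI)
      fix z assume "z \<in> frag_eval A b ` (?K #>\<^bsub>?F\<^esub> c)"
      then obtain k where "k \<in> ?K" "z = frag_eval A b (k \<otimes>\<^bsub>?F\<^esub> c)"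
        by (auto simp: r_coset_def)
      then show "z \<in> {frag_eval A b c}"
        using c K0[of k] e.hom_mult[of k c] e.hom_closed[of c] by simp
    next
      fix z assume "z \<in> {frag_eval A b c}"
      then show "z \<in> frag_eval A b ` (?K #>\<^bsub>?F\<^esub> c)"
        using F.rcos_self[OF c K] by blast
    qed
    then show ?thesis by (simp add: tensor_lift_def)
  qed
  interpret K: normal ?K ?F using K by (rule F.subgroup_imp_normal)
  show "tensor_lift A b \<in> hom (tensor_product R M N) (add_monoid A)"
  proof (rule homI)
    fix C D assume "C \<in> carrier (tensor_product R M N)" "D \<in> carrier (tensor_product R M N)"
    then obtain c d where cd: "c \<in> carrier ?F" "d \<in> carrier ?F" "C = ?K #>\<^bsub>?F\<^esub> c" "D = ?K #>\<^bsub>?F\<^esub> d"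
      by (auto simp: tensor_product_def carrier_FactGroup simp del: carrier_free_Abelian_group_iff)
    then have "C \<otimes>\<^bsub>tensor_product R M N\<^esub> D = ?K #>\<^bsub>?F\<^esub> (c \<otimes>\<^bsub>?F\<^esub> d)"
      by (simp only: tensor_product_def mult_FactGroup K.rcos_sum)
    then show "tensor_lift A b (C \<otimes>\<^bsub>tensor_product R M N\<^esub> D)
        = tensor_lift A b C \<otimes>\<^bsub>add_monoid A\<^esub> tensor_lift A b D"
      using cd by (simp only: lift F.m_closed e.hom_mult)
  next
    fix C assume "C \<in> carrier (tensor_product R M N)"
    then obtain c where "c \<in> carrier ?F" "C = ?K #>\<^bsub>?F\<^esub> c"
      by (auto simp: tensor_product_def carrier_FactGroup simp del: carrier_free_Abelian_group_iff)
    then show "tensor_lift A b C \<in> carrier (add_monoid A)"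
      by (simp only: lift e.hom_closed)
  qed
  show "tensor_lift A b (pure_tensor R M N x y) = b x y" if "x \<in> carrier M" "y \<in> carrier N"
    unfolding pure_tensor_def using that by (subst lift) (auto simp: of)
qed

lemma (in abelian_monoid) finsum_swap:
  assumes "finite A" "finite B" "\<And>i j. \<lbrakk>i \<in> A; j \<in> B\<rbrakk> \<Longrightarrow> f i j \<in> carrier G"
  shows "(\<Oplus>i\<in>A. \<Oplus>j\<in>B. f i j) = (\<Oplus>j\<in>B. \<Oplus>i\<in>A. f i j)"
  using assms(1,3)
proof (induction A rule: finite_induct)
  case empty
  then show ?case using assms(2) by simp
next
  case (insert a A)
  have "(\<Oplus>i\<in>insert a A. \<Oplus>j\<in>B. f i j) = (\<Oplus>j\<in>B. f a j) \<oplus> (\<Oplus>i\<in>A. \<Oplus>j\<in>B. f i j)"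
    using insert by (subst finsum_insert) (auto intro!: finsum_closed)
  also have "\<dots> = (\<Oplus>j\<in>B. f a j) \<oplus> (\<Oplus>j\<in>B. \<Oplus>i\<in>A. f i j)"
    using insert by simp
  also have "\<dots> = (\<Oplus>j\<in>B. f a j \<oplus> (\<Oplus>i\<in>A. f i j))"
    using insert by (subst finsum_addf) (auto intro!: finsum_closed)
  also have "\<dots> = (\<Oplus>j\<in>B. \<Oplus>i\<in>insert a A. f i j)"
    using insert by (intro finsum_cong') (auto intro!: finsum_closed finsum_insert[symmetric])
  finally show ?case .
qed

lemma coset_action_group_action:
  assumes "group G" "subgroup H G"
  shows "group_action G (lcosets\<^bsub>G\<^esub> H) (coset_action G H)"
proof -
  interpret group G by fact
  let ?E = "lcosets\<^bsub>G\<^esub> H"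
  have sub: "C \<subseteq> carrier G" if "C \<in> ?E" for C
    using subgroup.lcosets_carrier[OF assms(2,1) that] .
  have mem: "g <#\<^bsub>G\<^esub> C \<in> ?E" if "g \<in> carrier G" "C \<in> ?E" for g C
    using that subgroup.subset[OF assms(2)] by (auto simp: LCOSETS_def lcos_m_assoc)
  have Bij: "coset_action G H g \<in> Bij ?E" if g: "g \<in> carrier G" for g
  proof -
    have "bij_betw (coset_action G H g) ?E ?E"
      by (rule bij_betwI[where g = "\<lambda>C. inv\<^bsub>G\<^esub> g <#\<^bsub>G\<^esub> C"])
        (use g in \<open>auto simp: coset_action_def mem sub lcos_m_assoc lcos_mult_one\<close>)
    then show ?thesis by (simp add: Bij_def coset_action_def)
  qed
  have "coset_action G H \<in> hom G (BijGroup ?E)"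
  proof (rule homI)
    fix g h assume gh: "g \<in> carrier G" "h \<in> carrier G"
    then show "coset_action G H (g \<otimes>\<^bsub>G\<^esub> h)
        = coset_action G H g \<otimes>\<^bsub>BijGroup ?E\<^esub> coset_action G H h"
      using Bij by (auto simp: BijGroup_def compose_def coset_action_def mem sub lcos_m_assoc
        restrict_def fun_eq_iff)
  qed (use Bij in \<open>auto simp: BijGroup_def\<close>)
  then show ?thesis
    by (simp add: group_action_def group_hom_def group_hom_axioms_def group_BijGroup assms(1))
qed

lemma young_subgroup_is_subgroup: "subgroup (young_subgroup a b) (sym_group (a + b))"
proof -
  interpret group "sym_group (a + b)" by (rule sym_group_is_group)
  have inv: "inv\<^bsub>sym_group (a + b)\<^esub> p = Hilbert_Choice.inv p"
    if "p permutes {1..a+b}" for p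
    by (rule inv_equality) (use that in \<open>auto simp: sym_group_def permutes_inv permutes_inv_o\<close>)
  show ?thesis
  proof (rule subgroupI)
    show "young_subgroup a b \<noteq> {}"
      by (auto simp: young_subgroup_def sym_group_def permutes_id intro!: exI[of _ id])
  next
    fix p assume p: "p \<in> young_subgroup a b"
    then have perm: "p permutes {1..a+b}" by (simp add: young_subgroup_def sym_group_carrier)
    have "Hilbert_Choice.inv p ` A = A" if "p ` A = A" for A
      using that perm by (metis image_inv_f_f permutes_inj)
    with p perm show "inv\<^bsub>sym_group (a + b)\<^esub> p \<in> young_subgroup a b"
      by (simp add: young_subgroup_def sym_group_carrier inv permutes_inv)
  next
    fix p q assume "p \<in> young_subgroup a b" "q \<in> young_subgroup a b"
    then show "p \<otimes>\<^bsub>sym_group (a + b)\<^esub> q \<in> young_subgroup a b"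
      by (simp add: young_subgroup_def sym_group_def permutes_compose flip: image_image)
  qed (simp add: young_subgroup_def)
qed

lemma residue_map_ring_hom:
  assumes "discrete_valuation_ring R"
  shows "maximalideal (max_ideal R) R" "field (residue_field R)"
    "residue_map R \<in> ring_hom R (residue_field R)"
    "residue_map R ` carrier R = carrier (residue_field R)"
proof -
  interpret discrete_valuation_ring R by fact
  show max: "maximalideal (max_ideal R) R"
    unfolding max_ideal_def by (rule theI'[OF unique_maximalideal])
  interpret M: maximalideal "max_ideal R" R by fact
  show "field (residue_field R)"
    unfolding residue_field_def by (rule M.quotient_is_field[OF is_cring])
  show "residue_map R \<in> ring_hom R (residue_field R)"
    using M.rcos_ring_hom by (simp add: residue_field_def residue_map_def[abs_def])
  show "residue_map R ` carrier R = carrier (residue_field R)"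
    by (auto simp: residue_field_def residue_map_def FactRing_def A_RCOSETS_def')
qed

locale permutation_representation =
  cring S + group_action G X \<alpha>
  for S (structure) and G (structure) and X and \<alpha> +
  assumes finite_carrier [simp]: "finite (carrier G)"
begin

sublocale Grp: group G by (rule group_hom.axioms(1)[OF group_hom])

lemma act_closed [simp]: "\<lbrakk>g \<in> carrier G; x \<in> X\<rbrakk> \<Longrightarrow> \<alpha> g x \<in> X"
  using element_image by blast

lemma convolution_assoc:
  assumes a: "a \<in> carrier G \<rightarrow> carrier S" and b: "b \<in> carrier G \<rightarrow> carrier S"
    and w: "w \<in> carrier G \<rightarrow> carrier S"
  shows "(\<Oplus>k\<in>carrier G. (\<Oplus>h\<in>carrier G. a h \<otimes> b (inv\<^bsub>G\<^esub> h \<otimes>\<^bsub>G\<^esub> k)) \<otimes> w k)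
       = (\<Oplus>h\<in>carrier G. a h \<otimes> (\<Oplus>l\<in>carrier G. b l \<otimes> w (h \<otimes>\<^bsub>G\<^esub> l)))"
proof -
  note [simp] = funcset_mem[OF a] funcset_mem[OF b] funcset_mem[OF w]
  have "(\<Oplus>k\<in>carrier G. (\<Oplus>h\<in>carrier G. a h \<otimes> b (inv\<^bsub>G\<^esub> h \<otimes>\<^bsub>G\<^esub> k)) \<otimes> w k)
      = (\<Oplus>k\<in>carrier G. \<Oplus>h\<in>carrier G. a h \<otimes> b (inv\<^bsub>G\<^esub> h \<otimes>\<^bsub>G\<^esub> k) \<otimes> w k)"
    by (intro add.finprod_cong' finsum_ldistr) (auto intro!: finsum_closed)
  also have "\<dots> = (\<Oplus>h\<in>carrier G. \<Oplus>k\<in>carrier G. a h \<otimes> b (inv\<^bsub>G\<^esub> h \<otimes>\<^bsub>G\<^esub> k) \<otimes> w k)"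
    by (intro finsum_swap) auto
  also have "\<dots> = (\<Oplus>h\<in>carrier G. a h \<otimes> (\<Oplus>l\<in>carrier G. b l \<otimes> w (h \<otimes>\<^bsub>G\<^esub> l)))"
  proof (intro add.finprod_cong' refl)
    fix h assume h: "h \<in> carrier G"
    have "(\<Oplus>k\<in>carrier G. a h \<otimes> b (inv\<^bsub>G\<^esub> h \<otimes>\<^bsub>G\<^esub> k) \<otimes> w k)
        = (\<Oplus>k\<in>(\<otimes>\<^bsub>G\<^esub>) h ` carrier G. a h \<otimes> b (inv\<^bsub>G\<^esub> h \<otimes>\<^bsub>G\<^esub> k) \<otimes> w k)"
      using h by (simp add: Grp.surj_const_mult)
    also have "\<dots> = (\<Oplus>l\<in>carrier G. a h \<otimes> b (inv\<^bsub>G\<^esub> h \<otimes>\<^bsub>G\<^esub> (h \<otimes>\<^bsub>G\<^esub> l)) \<otimes> w (h \<otimes>\<^bsub>G\<^esub> l))"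
      using h by (intro finsum_reindex Grp.inj_on_cmult) auto
    also have "\<dots> = (\<Oplus>l\<in>carrier G. a h \<otimes> (b l \<otimes> w (h \<otimes>\<^bsub>G\<^esub> l)))"
      using h by (intro add.finprod_cong' refl) (auto simp: m_assoc Grp.m_assoc[symmetric])
    also have "\<dots> = a h \<otimes> (\<Oplus>l\<in>carrier G. b l \<otimes> w (h \<otimes>\<^bsub>G\<^esub> l))"
      using h by (intro finsum_rdistr[symmetric]) auto
    finally show "(\<Oplus>k\<in>carrier G. a h \<otimes> b (inv\<^bsub>G\<^esub> h \<otimes>\<^bsub>G\<^esub> k) \<otimes> w k)
        = a h \<otimes> (\<Oplus>l\<in>carrier G. b l \<otimes> w (h \<otimes>\<^bsub>G\<^esub> l))" .
  qed (auto intro!: finsum_closed)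
  finally show ?thesis .
qed


lemma finsum_eqI:
  assumes "\<And>g. g \<in> carrier G \<Longrightarrow> f g = f' g" "\<And>g. g \<in> carrier G \<Longrightarrow> f' g \<in> carrier S"
  shows "(\<Oplus>g\<in>carrier G. f g) = (\<Oplus>g\<in>carrier G. f' g)"
  using assms by (intro add.finprod_cong') auto

lemma finsum_delta:
  assumes "h \<in> carrier G" "f \<in> carrier G \<rightarrow> carrier S"
  shows "(\<Oplus>g\<in>carrier G. (if g = h then \<one> else \<zero>) \<otimes> f g) = f h"
proof -
  have "(\<Oplus>g\<in>carrier G. (if g = h then \<one> else \<zero>) \<otimes> f g)
      = (\<Oplus>g\<in>carrier G. if h = g then f g else \<zero>)"
    using assms by (intro finsum_eqI) (auto simp: Pi_iff)
  also have "\<dots> = f h"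
    using assms add.finprod_singleton[of h "carrier G" f] by simp
  finally show ?thesis .
qed

lemma finsum_delta_right:
  assumes "g \<in> carrier G" "f \<in> carrier G \<rightarrow> carrier S"
  shows "(\<Oplus>h\<in>carrier G. f h \<otimes> (if inv\<^bsub>G\<^esub> h \<otimes>\<^bsub>G\<^esub> g = \<one>\<^bsub>G\<^esub> then \<one> else \<zero>)) = f g"
proof -
  have eq: "inv\<^bsub>G\<^esub> h \<otimes>\<^bsub>G\<^esub> g = \<one>\<^bsub>G\<^esub> \<longleftrightarrow> h = g" if "h \<in> carrier G" for h
    using that assms(1) by (metis Grp.inv_closed Grp.inv_equality Grp.inv_inv Grp.l_inv)
  have "(\<Oplus>h\<in>carrier G. f h \<otimes> (if inv\<^bsub>G\<^esub> h \<otimes>\<^bsub>G\<^esub> g = \<one>\<^bsub>G\<^esub> then \<one> else \<zero>))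
      = (\<Oplus>h\<in>carrier G. (if h = g then \<one> else \<zero>) \<otimes> f h)"
    using assms by (intro finsum_eqI) (auto simp: eq Pi_iff)
  then show ?thesis using finsum_delta[OF assms] by simp
qed

lemma finsum_l_distr:
  assumes "a \<in> carrier G \<rightarrow> carrier S" "b \<in> carrier G \<rightarrow> carrier S" "w \<in> carrier G \<rightarrow> carrier S"
  shows "(\<Oplus>g\<in>carrier G. (a g \<oplus> b g) \<otimes> w g)
    = (\<Oplus>g\<in>carrier G. a g \<otimes> w g) \<oplus> (\<Oplus>g\<in>carrier G. b g \<otimes> w g)"
proof -
  have "(\<Oplus>g\<in>carrier G. (a g \<oplus> b g) \<otimes> w g) = (\<Oplus>g\<in>carrier G. a g \<otimes> w g \<oplus> b g \<otimes> w g)"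
    using assms by (intro finsum_eqI) (auto simp: Pi_iff l_distr)
  then show ?thesis
    using assms by (simp add: finsum_addf Pi_iff)
qed

lemma finsum_r_distr:
  assumes "a \<in> carrier G \<rightarrow> carrier S" "b \<in> carrier G \<rightarrow> carrier S" "w \<in> carrier G \<rightarrow> carrier S"
  shows "(\<Oplus>g\<in>carrier G. w g \<otimes> (a g \<oplus> b g))
    = (\<Oplus>g\<in>carrier G. w g \<otimes> a g) \<oplus> (\<Oplus>g\<in>carrier G. w g \<otimes> b g)"
proof -
  have "(\<Oplus>g\<in>carrier G. w g \<otimes> (a g \<oplus> b g)) = (\<Oplus>g\<in>carrier G. w g \<otimes> a g \<oplus> w g \<otimes> b g)"
    using assms by (intro finsum_eqI) (auto simp: Pi_iff r_distr)
  then show ?thesis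
    using assms by (simp add: finsum_addf Pi_iff)
qed

lemma abelian_group_group_algebra: "abelian_group (group_algebra S G)"
proof (rule abelian_groupI)
  fix a assume a: "a \<in> carrier (group_algebra S G)"
  then have mem [simp]: "\<And>g. g \<in> carrier G \<Longrightarrow> a g \<in> carrier S"
    and ext: "a \<in> extensional (carrier G)"
    by (auto simp: group_algebra_def PiE_def)
  show "\<exists>b\<in>carrier (group_algebra S G). b \<oplus>\<^bsub>group_algebra S G\<^esub> a = \<zero>\<^bsub>group_algebra S G\<^esub>"
    by (rule bexI[of _ "\<lambda>g\<in>carrier G. \<ominus> a g"])
      (auto simp: group_algebra_def l_neg intro!: restrict_ext)
  show "\<zero>\<^bsub>group_algebra S G\<^esub> \<oplus>\<^bsub>group_algebra S G\<^esub> a = a"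
    by (rule extensionalityI[OF _ ext]) (simp_all add: group_algebra_def)
  fix b assume "b \<in> carrier (group_algebra S G)"
  then have [simp]: "\<And>g. g \<in> carrier G \<Longrightarrow> b g \<in> carrier S"
    by (auto simp: group_algebra_def)
  show "a \<oplus>\<^bsub>group_algebra S G\<^esub> b \<in> carrier (group_algebra S G)"
    by (auto simp: group_algebra_def)
  show "a \<oplus>\<^bsub>group_algebra S G\<^esub> b = b \<oplus>\<^bsub>group_algebra S G\<^esub> a"
    by (auto simp: group_algebra_def a_comm intro!: restrict_ext)
  fix c assume "c \<in> carrier (group_algebra S G)"
  then have [simp]: "\<And>g. g \<in> carrier G \<Longrightarrow> c g \<in> carrier S"
    by (auto simp: group_algebra_def)
  show "a \<oplus>\<^bsub>group_algebra S G\<^esub> b \<oplus>\<^bsub>group_algebra S G\<^esub> c = a \<oplus>\<^bsub>group_algebra S G\<^esub> (b \<oplus>\<^bsub>group_algebra S G\<^esub> c)"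
    by (auto simp: group_algebra_def a_assoc intro!: restrict_ext)
qed (auto simp: group_algebra_def)

lemma abelian_group_perm_module: "abelian_group (perm_module S G X \<alpha>)"
proof (rule abelian_groupI)
  fix a assume a: "a \<in> carrier (perm_module S G X \<alpha>)"
  then have mem [simp]: "\<And>x. x \<in> X \<Longrightarrow> a x \<in> carrier S"
    and ext: "a \<in> extensional (X)"
    by (auto simp: perm_module_def PiE_def)
  show "\<exists>b\<in>carrier (perm_module S G X \<alpha>). b \<oplus>\<^bsub>perm_module S G X \<alpha>\<^esub> a = \<zero>\<^bsub>perm_module S G X \<alpha>\<^esub>"
    by (rule bexI[of _ "\<lambda>x\<in>X. \<ominus> a x"])
      (auto simp: perm_module_def l_neg intro!: restrict_ext)
  show "\<zero>\<^bsub>perm_module S G X \<alpha>\<^esub> \<oplus>\<^bsub>perm_module S G X \<alpha>\<^esub> a = a"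
    by (rule extensionalityI[OF _ ext]) (simp_all add: perm_module_def)
  fix b assume "b \<in> carrier (perm_module S G X \<alpha>)"
  then have [simp]: "\<And>x. x \<in> X \<Longrightarrow> b x \<in> carrier S"
    by (auto simp: perm_module_def)
  show "a \<oplus>\<^bsub>perm_module S G X \<alpha>\<^esub> b \<in> carrier (perm_module S G X \<alpha>)"
    by (auto simp: perm_module_def)
  show "a \<oplus>\<^bsub>perm_module S G X \<alpha>\<^esub> b = b \<oplus>\<^bsub>perm_module S G X \<alpha>\<^esub> a"
    by (auto simp: perm_module_def a_comm intro!: restrict_ext)
  fix c assume "c \<in> carrier (perm_module S G X \<alpha>)"
  then have [simp]: "\<And>x. x \<in> X \<Longrightarrow> c x \<in> carrier S"
    by (auto simp: perm_module_def)
  show "a \<oplus>\<^bsub>perm_module S G X \<alpha>\<^esub> b \<oplus>\<^bsub>perm_module S G X \<alpha>\<^esub> c = a \<oplus>\<^bsub>perm_module S G X \<alpha>\<^esub> (b \<oplus>\<^bsub>perm_module S G X \<alpha>\<^esub> c)"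
    by (auto simp: perm_module_def a_assoc intro!: restrict_ext)
qed (auto simp: perm_module_def)

lemma ring_group_algebra: "ring (group_algebra S G)"
proof (rule ringI)
  show "abelian_group (group_algebra S G)" by (rule abelian_group_group_algebra)
  show "Group.monoid (group_algebra S G)"
  proof (rule monoidI)
    fix a b c
    assume abc: "a \<in> carrier (group_algebra S G)" "b \<in> carrier (group_algebra S G)"
      "c \<in> carrier (group_algebra S G)"
    then have [simp]: "a g \<in> carrier S" "b g \<in> carrier S" "c g \<in> carrier S" if "g \<in> carrier G" for g
      using that by (auto simp: group_algebra_def)
    have "(a \<otimes>\<^bsub>group_algebra S G\<^esub> b \<otimes>\<^bsub>group_algebra S G\<^esub> c) g
        = (a \<otimes>\<^bsub>group_algebra S G\<^esub> (b \<otimes>\<^bsub>group_algebra S G\<^esub> c)) g" if g: "g \<in> carrier G" for g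
    proof -
      have "(\<Oplus>k\<in>carrier G. (\<Oplus>h\<in>carrier G. a h \<otimes> b (inv\<^bsub>G\<^esub> h \<otimes>\<^bsub>G\<^esub> k)) \<otimes> c (inv\<^bsub>G\<^esub> k \<otimes>\<^bsub>G\<^esub> g))
        = (\<Oplus>h\<in>carrier G. a h \<otimes> (\<Oplus>l\<in>carrier G. b l \<otimes> c (inv\<^bsub>G\<^esub> (h \<otimes>\<^bsub>G\<^esub> l) \<otimes>\<^bsub>G\<^esub> g)))"
        using g by (intro convolution_assoc) auto
      also have "\<dots> = (\<Oplus>h\<in>carrier G. a h \<otimes> (\<Oplus>l\<in>carrier G. b l \<otimes> c (inv\<^bsub>G\<^esub> l \<otimes>\<^bsub>G\<^esub> (inv\<^bsub>G\<^esub> h \<otimes>\<^bsub>G\<^esub> g))))"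
        using g by (intro finsum_eqI arg_cong2[where f = "(\<otimes>)"] m_closed finsum_closed)
          (auto simp: Grp.inv_mult_group Grp.m_assoc)
      finally show ?thesis
        using g by (simp add: group_algebra_def cong: finsum_cong)
    qed
    then show "a \<otimes>\<^bsub>group_algebra S G\<^esub> b \<otimes>\<^bsub>group_algebra S G\<^esub> c
        = a \<otimes>\<^bsub>group_algebra S G\<^esub> (b \<otimes>\<^bsub>group_algebra S G\<^esub> c)"
      by (auto simp: group_algebra_def fun_eq_iff)
  next
    fix a assume a: "a \<in> carrier (group_algebra S G)"
    then have [simp]: "a g \<in> carrier S" if "g \<in> carrier G" for g
      using that by (auto simp: group_algebra_def)
    have ext: "a \<in> extensional (carrier G)" "b \<otimes>\<^bsub>group_algebra S G\<^esub> c \<in> extensional (carrier G)" for b c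
      using a by (auto simp: group_algebra_def PiE_def)
    have "(\<one>\<^bsub>group_algebra S G\<^esub> \<otimes>\<^bsub>group_algebra S G\<^esub> a) g = a g" if "g \<in> carrier G" for g
      using that finsum_delta[of "\<one>\<^bsub>G\<^esub>" "\<lambda>h. a (inv\<^bsub>G\<^esub> h \<otimes>\<^bsub>G\<^esub> g)"]
      by (simp add: group_algebra_def cong: finsum_cong)
    then show "\<one>\<^bsub>group_algebra S G\<^esub> \<otimes>\<^bsub>group_algebra S G\<^esub> a = a"
      by (rule extensionalityI[OF ext(2) ext(1)])
    have "(a \<otimes>\<^bsub>group_algebra S G\<^esub> \<one>\<^bsub>group_algebra S G\<^esub>) g = a g" if "g \<in> carrier G" for g
      using that finsum_delta_right[of g a]
      by (simp add: group_algebra_def cong: finsum_cong)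
    then show "a \<otimes>\<^bsub>group_algebra S G\<^esub> \<one>\<^bsub>group_algebra S G\<^esub> = a"
      by (rule extensionalityI[OF ext(2) ext(1)])
  qed (auto simp: group_algebra_def PiE_iff intro!: finsum_closed)
next
  fix a b c
  assume "a \<in> carrier (group_algebra S G)" "b \<in> carrier (group_algebra S G)"
    "c \<in> carrier (group_algebra S G)"
  then have [simp]: "a g \<in> carrier S" "b g \<in> carrier S" "c g \<in> carrier S" if "g \<in> carrier G" for g
    using that by (auto simp: group_algebra_def)
  show "(a \<oplus>\<^bsub>group_algebra S G\<^esub> b) \<otimes>\<^bsub>group_algebra S G\<^esub> c
      = a \<otimes>\<^bsub>group_algebra S G\<^esub> c \<oplus>\<^bsub>group_algebra S G\<^esub> b \<otimes>\<^bsub>group_algebra S G\<^esub> c"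
    by (auto simp: group_algebra_def finsum_l_distr Pi_iff intro!: restrict_ext cong: finsum_cong)
  show "c \<otimes>\<^bsub>group_algebra S G\<^esub> (a \<oplus>\<^bsub>group_algebra S G\<^esub> b)
      = c \<otimes>\<^bsub>group_algebra S G\<^esub> a \<oplus>\<^bsub>group_algebra S G\<^esub> c \<otimes>\<^bsub>group_algebra S G\<^esub> b"
    by (auto simp: group_algebra_def finsum_r_distr Pi_iff intro!: restrict_ext cong: finsum_cong)
qed

lemma left_module_perm_module: "left_module (group_algebra S G) (perm_module S G X \<alpha>)"
proof (intro left_module.intro left_module_axioms.intro)
  show "ring (group_algebra S G)" by (rule ring_group_algebra)
  show "abelian_group (perm_module S G X \<alpha>)" by (rule abelian_group_perm_module)
next
  fix a b v
  assume abv: "a \<in> carrier (group_algebra S G)" "b \<in> carrier (group_algebra S G)"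
      "v \<in> carrier (perm_module S G X \<alpha>)"
  then have [simp]: "a g \<in> carrier S" "b g \<in> carrier S" if "g \<in> carrier G" for g
    using that by (auto simp: group_algebra_def)
  have [simp]: "v x \<in> carrier S" if "x \<in> X" for x
    using that abv by (auto simp: perm_module_def)
  have "(\<Oplus>k\<in>carrier G. (\<Oplus>h\<in>carrier G. a h \<otimes> b (inv\<^bsub>G\<^esub> h \<otimes>\<^bsub>G\<^esub> k)) \<otimes> v (\<alpha> (inv\<^bsub>G\<^esub> k) x))
      = (\<Oplus>h\<in>carrier G. a h \<otimes> (\<Oplus>l\<in>carrier G. b l \<otimes> v (\<alpha> (inv\<^bsub>G\<^esub> l) (\<alpha> (inv\<^bsub>G\<^esub> h) x))))"
    if x: "x \<in> X" for x
  proof -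
    have "(\<Oplus>k\<in>carrier G. (\<Oplus>h\<in>carrier G. a h \<otimes> b (inv\<^bsub>G\<^esub> h \<otimes>\<^bsub>G\<^esub> k)) \<otimes> v (\<alpha> (inv\<^bsub>G\<^esub> k) x))
        = (\<Oplus>h\<in>carrier G. a h \<otimes> (\<Oplus>l\<in>carrier G. b l \<otimes> v (\<alpha> (inv\<^bsub>G\<^esub> (h \<otimes>\<^bsub>G\<^esub> l)) x)))"
      using x by (intro convolution_assoc) auto
    also have "\<dots> = (\<Oplus>h\<in>carrier G. a h \<otimes> (\<Oplus>l\<in>carrier G. b l \<otimes> v (\<alpha> (inv\<^bsub>G\<^esub> l) (\<alpha> (inv\<^bsub>G\<^esub> h) x))))"
      using x by (intro finsum_eqI arg_cong2[where f = "(\<otimes>)"] m_closed finsum_closed)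
        (auto simp: Grp.inv_mult_group composition_rule)
    finally show ?thesis .
  qed
  then show "(a \<otimes>\<^bsub>group_algebra S G\<^esub> b) \<odot>\<^bsub>perm_module S G X \<alpha>\<^esub> v
      = a \<odot>\<^bsub>perm_module S G X \<alpha>\<^esub> (b \<odot>\<^bsub>perm_module S G X \<alpha>\<^esub> v)"
    by (auto simp: group_algebra_def perm_module_def fun_eq_iff cong: finsum_cong)
next
  fix v assume v: "v \<in> carrier (perm_module S G X \<alpha>)"
  then have [simp]: "v x \<in> carrier S" if "x \<in> X" for x
    using that by (auto simp: perm_module_def)
  have one: "\<alpha> \<one>\<^bsub>G\<^esub> x = x" if "x \<in> X" for x
    using that by (simp flip: id_eq_one)
  have "(\<one>\<^bsub>group_algebra S G\<^esub> \<odot>\<^bsub>perm_module S G X \<alpha>\<^esub> v) x = v x" if "x \<in> X" for x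
    using that finsum_delta[of "\<one>\<^bsub>G\<^esub>" "\<lambda>g. v (\<alpha> (inv\<^bsub>G\<^esub> g) x)"]
    by (simp add: group_algebra_def perm_module_def one cong: finsum_cong)
  moreover have "v \<in> extensional X" "a \<odot>\<^bsub>perm_module S G X \<alpha>\<^esub> v \<in> extensional X" for a
    using v by (auto simp: perm_module_def PiE_def)
  ultimately show "\<one>\<^bsub>group_algebra S G\<^esub> \<odot>\<^bsub>perm_module S G X \<alpha>\<^esub> v = v"
    by (blast intro: extensionalityI)
next
  fix a b v
  assume "a \<in> carrier (group_algebra S G)" "b \<in> carrier (group_algebra S G)"
    "v \<in> carrier (perm_module S G X \<alpha>)"
  then have [simp]: "\<And>g. g \<in> carrier G \<Longrightarrow> a g \<in> carrier S"
      "\<And>g. g \<in> carrier G \<Longrightarrow> b g \<in> carrier S" "\<And>x. x \<in> X \<Longrightarrow> v x \<in> carrier S"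
    by (auto simp: group_algebra_def perm_module_def)
  show "(a \<oplus>\<^bsub>group_algebra S G\<^esub> b) \<odot>\<^bsub>perm_module S G X \<alpha>\<^esub> v
      = a \<odot>\<^bsub>perm_module S G X \<alpha>\<^esub> v \<oplus>\<^bsub>perm_module S G X \<alpha>\<^esub> b \<odot>\<^bsub>perm_module S G X \<alpha>\<^esub> v"
    by (auto simp: group_algebra_def perm_module_def finsum_l_distr Pi_iff intro!: restrict_ext cong: finsum_cong)
next
  fix a v w
  assume "a \<in> carrier (group_algebra S G)" "v \<in> carrier (perm_module S G X \<alpha>)"
    "w \<in> carrier (perm_module S G X \<alpha>)"
  then have [simp]: "\<And>g. g \<in> carrier G \<Longrightarrow> a g \<in> carrier S"
      "\<And>x. x \<in> X \<Longrightarrow> w x \<in> carrier S" "\<And>x. x \<in> X \<Longrightarrow> v x \<in> carrier S"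
    by (auto simp: group_algebra_def perm_module_def)
  show "a \<odot>\<^bsub>perm_module S G X \<alpha>\<^esub> (v \<oplus>\<^bsub>perm_module S G X \<alpha>\<^esub> w)
      = a \<odot>\<^bsub>perm_module S G X \<alpha>\<^esub> v \<oplus>\<^bsub>perm_module S G X \<alpha>\<^esub> a \<odot>\<^bsub>perm_module S G X \<alpha>\<^esub> w"
    by (auto simp: group_algebra_def perm_module_def finsum_r_distr Pi_iff intro!: restrict_ext cong: finsum_cong)
next
  fix a v
  assume "a \<in> carrier (group_algebra S G)" "v \<in> carrier (perm_module S G X \<alpha>)"
  then show "a \<odot>\<^bsub>perm_module S G X \<alpha>\<^esub> v \<in> carrier (perm_module S G X \<alpha>)"
    by (auto simp: group_algebra_def perm_module_def PiE_iff intro!: finsum_closed)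
qed

lemma module_group_algebra: "module S (group_algebra S G)"
proof (rule moduleI)
  show "cring S" by (rule is_cring)
  show "abelian_group (group_algebra S G)" by (rule abelian_group_group_algebra)
next
  fix x assume "x \<in> carrier (group_algebra S G)"
  then have "x \<in> extensional (carrier G)" and [simp]: "\<And>g. g \<in> carrier G \<Longrightarrow> x g \<in> carrier S"
    by (auto simp: group_algebra_def PiE_def)
  then show "\<one> \<odot>\<^bsub>group_algebra S G\<^esub> x = x"
    by (intro extensionalityI[of _ "carrier G"]) (simp_all add: group_algebra_def)
qed (auto simp: group_algebra_def PiE_iff l_distr r_distr m_assoc intro!: restrict_ext)

lemma mem_annihilator_iff:
  "a \<in> annihilator (group_algebra S G) (perm_module S G X \<alpha>) \<longleftrightarrow>
     a \<in> carrier (group_algebra S G) \<and>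
     (\<forall>x\<in>X. \<forall>y\<in>X. (\<Oplus>g\<in>carrier G. a g \<otimes> (if \<alpha> (inv\<^bsub>G\<^esub> g) x = y then \<one> else \<zero>)) = \<zero>)"
  (is "?ann \<longleftrightarrow> ?mem \<and> ?sums")
proof
  assume ann: ?ann
  have "(\<Oplus>g\<in>carrier G. a g \<otimes> (if \<alpha> (inv\<^bsub>G\<^esub> g) x = y then \<one> else \<zero>)) = \<zero>"
    if "x \<in> X" "y \<in> X" for x y
  proof -
    let ?v = "\<lambda>z\<in>X. if z = y then \<one> else \<zero>"
    have "?v \<in> carrier (perm_module S G X \<alpha>)" by (auto simp: perm_module_def)
    then have "(a \<odot>\<^bsub>perm_module S G X \<alpha>\<^esub> ?v) x = \<zero>\<^bsub>perm_module S G X \<alpha>\<^esub> x"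
      using ann by (auto simp: annihilator_def)
    moreover have "(a \<odot>\<^bsub>perm_module S G X \<alpha>\<^esub> ?v) x
        = (\<Oplus>g\<in>carrier G. a g \<otimes> (if \<alpha> (inv\<^bsub>G\<^esub> g) x = y then \<one> else \<zero>))"
      using ann \<open>x \<in> X\<close>
      by (auto simp: perm_module_def annihilator_def group_algebra_def PiE_iff intro!: finsum_eqI)
    ultimately show ?thesis using \<open>x \<in> X\<close> by (simp add: perm_module_def)
  qed
  then show "?mem \<and> ?sums" using ann by (simp add: annihilator_def)
next
  assume *: "?mem \<and> ?sums"
  then have [simp]: "a g \<in> carrier S" if "g \<in> carrier G" for g
    using that by (auto simp: group_algebra_def)
  have "(\<Oplus>g\<in>carrier G. a g \<otimes> v (\<alpha> (inv\<^bsub>G\<^esub> g) x)) = \<zero>"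
    if v: "v \<in> X \<rightarrow>\<^sub>E carrier S" and x: "x \<in> X" for v x
  proof -
    have [simp]: "v y \<in> carrier S" if "y \<in> X" for y using that v by auto
    define Y where "Y = (\<lambda>g. \<alpha> (inv\<^bsub>G\<^esub> g) x) ` carrier G"
    have Y: "finite Y" "Y \<subseteq> X" using x by (auto simp: Y_def)
    have [simp]: "y \<in> X" if "y \<in> Y" for y using that Y by auto
    let ?d = "\<lambda>g y. if \<alpha> (inv\<^bsub>G\<^esub> g) x = y then \<one> else \<zero>"
    have "(\<Oplus>g\<in>carrier G. a g \<otimes> v (\<alpha> (inv\<^bsub>G\<^esub> g) x))
        = (\<Oplus>g\<in>carrier G. \<Oplus>y\<in>Y. a g \<otimes> ?d g y \<otimes> v y)"
    proof (rule finsum_eqI)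
      fix g assume g: "g \<in> carrier G"
      then have gx: "\<alpha> (inv\<^bsub>G\<^esub> g) x \<in> Y" by (auto simp: Y_def)
      have "(\<Oplus>y\<in>Y. a g \<otimes> ?d g y \<otimes> v y)
          = (\<Oplus>y\<in>Y. if \<alpha> (inv\<^bsub>G\<^esub> g) x = y then a g \<otimes> v y else \<zero>)"
        using g by (intro add.finprod_cong') auto
      also have "\<dots> = a g \<otimes> v (\<alpha> (inv\<^bsub>G\<^esub> g) x)"
        using g gx Y(1) add.finprod_singleton[of "\<alpha> (inv\<^bsub>G\<^esub> g) x" Y "\<lambda>y. a g \<otimes> v y"]
        by simp
      finally show "a g \<otimes> v (\<alpha> (inv\<^bsub>G\<^esub> g) x) = (\<Oplus>y\<in>Y. a g \<otimes> ?d g y \<otimes> v y)" ..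
    qed (auto intro!: finsum_closed)
    also have "\<dots> = (\<Oplus>y\<in>Y. \<Oplus>g\<in>carrier G. a g \<otimes> ?d g y \<otimes> v y)"
      using Y by (intro finsum_swap) auto
    also have "\<dots> = (\<Oplus>y\<in>Y. (\<Oplus>g\<in>carrier G. a g \<otimes> ?d g y) \<otimes> v y)"
      by (intro add.finprod_cong' refl finsum_ldistr[symmetric]) (auto intro!: finsum_closed)
    also have "\<dots> = (\<Oplus>y\<in>Y. \<zero>)"
      using * x by (intro add.finprod_cong' refl) (auto simp del: if_distrib)
    also have "\<dots> = \<zero>" by simp
    finally show ?thesis .
  qed
  then show ?ann
    using * by (auto simp: annihilator_def perm_module_def intro!: restrict_ext)
qed

lemma module_Ann_perm: "module S (Ann_perm S G X \<alpha>)"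
proof -
  interpret A: module S "group_algebra S G" by (rule module_group_algebra)
  interpret P: left_module "group_algebra S G" "perm_module S G X \<alpha>"
    by (rule left_module_perm_module)
  let ?I = "annihilator (group_algebra S G) (perm_module S G X \<alpha>)"
  have zero: "\<zero>\<^bsub>group_algebra S G\<^esub> \<odot>\<^bsub>perm_module S G X \<alpha>\<^esub> v = \<zero>\<^bsub>perm_module S G X \<alpha>\<^esub>"
    if v: "v \<in> carrier (perm_module S G X \<alpha>)" for v
    using v P.smult_l_distr[of "\<zero>\<^bsub>group_algebra S G\<^esub>" "\<zero>\<^bsub>group_algebra S G\<^esub>" v] 
    by (simp add: P.P.add.r_cancel_one')
  have smult: "s \<odot>\<^bsub>group_algebra S G\<^esub> a \<in> ?I" if s: "s \<in> carrier S" and a: "a \<in> ?I" for s a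
  proof -
    have [simp]: "a g \<in> carrier S" if "g \<in> carrier G" for g
      using a that by (auto simp: annihilator_def group_algebra_def)
    have "(\<Oplus>g\<in>carrier G. (s \<odot>\<^bsub>group_algebra S G\<^esub> a) g \<otimes> (if \<alpha> (inv\<^bsub>G\<^esub> g) x = y then \<one> else \<zero>)) = \<zero>"
      if "x \<in> X" "y \<in> X" for x y
    proof -
      have "(\<Oplus>g\<in>carrier G. (s \<odot>\<^bsub>group_algebra S G\<^esub> a) g \<otimes> (if \<alpha> (inv\<^bsub>G\<^esub> g) x = y then \<one> else \<zero>))
        = (\<Oplus>g\<in>carrier G. s \<otimes> (a g \<otimes> (if \<alpha> (inv\<^bsub>G\<^esub> g) x = y then \<one> else \<zero>)))"
        using s by (intro finsum_eqI) (auto simp: group_algebra_def m_assoc)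
      also have "\<dots> = s \<otimes> (\<Oplus>g\<in>carrier G. a g \<otimes> (if \<alpha> (inv\<^bsub>G\<^esub> g) x = y then \<one> else \<zero>))"
        using s by (intro finsum_rdistr[symmetric]) auto
      also have "\<dots> = \<zero>"
        using a s that by (simp add: mem_annihilator_iff)
      finally show ?thesis .
    qed
    then show ?thesis
      using a s by (simp add: mem_annihilator_iff)
  qed
  have neg: "\<ominus>\<^bsub>group_algebra S G\<^esub> a \<in> ?I" if a: "a \<in> ?I" for a
  proof -
    have "\<ominus> \<one> \<odot>\<^bsub>group_algebra S G\<^esub> a = \<ominus>\<^bsub>group_algebra S G\<^esub> a"
      using a A.smult_l_minus[of \<one> a] by (simp add: annihilator_def)
    then show ?thesis using smult[of "\<ominus> \<one>" a] a by simp
  qed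
  have "submodule ?I S (group_algebra S G)"
    by (rule A.submoduleI) (auto simp: smult neg, auto simp: annihilator_def zero P.smult_l_distr)
  then show ?thesis
    unfolding Ann_perm_def by (rule submodule.submodule_is_module) (rule module_group_algebra)
qed

end

lemma module_restrict_scalars:
  assumes "cring R" "cring S" "\<phi> \<in> ring_hom R S"
  shows "module R (restrict_scalars S \<phi>)"
proof -
  interpret R: cring R by fact
  interpret S: cring S by fact
  interpret ring_hom_cring R S \<phi> by (intro ring_hom_cring.intro ring_hom_cring_axioms.intro) fact+
  have "abelian_group (restrict_scalars S \<phi>)"
    by (rule abelian_groupI)
      (auto simp: restrict_scalars_def S.a_ac dest: S.l_neg intro: S.a_inv_closed)
  then show ?thesis
    by (intro moduleI R.is_cring)
      (auto simp: restrict_scalars_def S.l_distr S.r_distr S.m_assoc)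
qed

lemma base_change_map:
  assumes R: "permutation_representation R G X \<alpha>" and S: "permutation_representation S G X \<alpha>"
    and \<phi>: "\<phi> \<in> ring_hom R S"
  shows "base_change_map S \<phi> G X \<alpha>
      \<in> hom (tensor_product R (restrict_scalars S \<phi>) (Ann_perm R G X \<alpha>))
            (add_monoid (Ann_perm S G X \<alpha>))"
    and "\<lbrakk>s \<in> carrier S; a \<in> carrier (Ann_perm R G X \<alpha>)\<rbrakk> \<Longrightarrow>
      base_change_map S \<phi> G X \<alpha> (pure_tensor R (restrict_scalars S \<phi>) (Ann_perm R G X \<alpha>) s a)
        = s \<odot>\<^bsub>group_algebra S G\<^esub> (\<lambda>g\<in>carrier G. \<phi> (a g))"
proof -
  interpret R: permutation_representation R G X \<alpha> by fact
  interpret S: permutation_representation S G X \<alpha> by fact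
  interpret ring_hom_cring R S \<phi> 
    by (intro ring_hom_cring.intro ring_hom_cring_axioms.intro R.is_cring S.is_cring \<phi>)
  interpret A: module S "Ann_perm S G X \<alpha>" by (rule S.module_Ann_perm)
  have carr: "a g \<in> carrier R" if "a \<in> carrier (Ann_perm R G X \<alpha>)" "g \<in> carrier G" for a g
    using that by (auto simp: Ann_perm_def annihilator_def group_algebra_def)
  have img: "(\<lambda>g\<in>carrier G. \<phi> (a g)) \<in> carrier (Ann_perm S G X \<alpha>)"
    if a: "a \<in> carrier (Ann_perm R G X \<alpha>)" for a
  proof -
    note [simp] = carr[OF a]
    have "(\<Oplus>\<^bsub>S\<^esub>g\<in>carrier G. (\<lambda>g\<in>carrier G. \<phi> (a g)) g \<otimes>\<^bsub>S\<^esub>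
        (if \<alpha> (inv\<^bsub>G\<^esub> g) x = y then \<one>\<^bsub>S\<^esub> else \<zero>\<^bsub>S\<^esub>)) = \<zero>\<^bsub>S\<^esub>" if "x \<in> X" "y \<in> X" for x y
    proof -
      have "\<zero>\<^bsub>S\<^esub> = \<phi> (\<Oplus>\<^bsub>R\<^esub>g\<in>carrier G. a g \<otimes>\<^bsub>R\<^esub>
          (if \<alpha> (inv\<^bsub>G\<^esub> g) x = y then \<one>\<^bsub>R\<^esub> else \<zero>\<^bsub>R\<^esub>))"
        using a that by (simp add: Ann_perm_def R.mem_annihilator_iff)
      also have "\<dots> = (\<Oplus>\<^bsub>S\<^esub>g\<in>carrier G. (\<phi> \<circ> (\<lambda>g. a g \<otimes>\<^bsub>R\<^esub>
          (if \<alpha> (inv\<^bsub>G\<^esub> g) x = y then \<one>\<^bsub>R\<^esub> else \<zero>\<^bsub>R\<^esub>))) g)"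
        by (intro hom_finsum) auto
      also have "\<dots> = (\<Oplus>\<^bsub>S\<^esub>g\<in>carrier G. (\<lambda>g\<in>carrier G. \<phi> (a g)) g \<otimes>\<^bsub>S\<^esub>
          (if \<alpha> (inv\<^bsub>G\<^esub> g) x = y then \<one>\<^bsub>S\<^esub> else \<zero>\<^bsub>S\<^esub>))"
        by (intro S.finsum_eqI) auto
      finally show ?thesis ..
    qed
    moreover have "(\<lambda>g\<in>carrier G. \<phi> (a g)) \<in> carrier (group_algebra S G)"
      by (simp add: group_algebra_def)
    ultimately show ?thesis
      by (simp add: Ann_perm_def S.mem_annihilator_iff)
  qed
  have ops: "carrier (restrict_scalars S \<phi>) = carrier S"
    "ring.add (restrict_scalars S \<phi>) = ring.add S" "smult (restrict_scalars S \<phi>) r s = \<phi> r \<otimes>\<^bsub>S\<^esub> s"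
    "smult (Ann_perm S G X \<alpha>) = smult (group_algebra S G)" for r s
    by (simp_all add: restrict_scalars_def Ann_perm_def)
  let ?b = "\<lambda>s a. s \<odot>\<^bsub>Ann_perm S G X \<alpha>\<^esub> (\<lambda>g\<in>carrier G. \<phi> (a g))"
  have add: "(\<lambda>g\<in>carrier G. \<phi> ((a \<oplus>\<^bsub>Ann_perm R G X \<alpha>\<^esub> a') g))
      = (\<lambda>g\<in>carrier G. \<phi> (a g)) \<oplus>\<^bsub>Ann_perm S G X \<alpha>\<^esub> (\<lambda>g\<in>carrier G. \<phi> (a' g))"
    if "a \<in> carrier (Ann_perm R G X \<alpha>)" "a' \<in> carrier (Ann_perm R G X \<alpha>)" for a a'
    using that[THEN carr] by (auto simp: Ann_perm_def group_algebra_def intro!: restrict_ext)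
  have smult: "(\<lambda>g\<in>carrier G. \<phi> ((r \<odot>\<^bsub>Ann_perm R G X \<alpha>\<^esub> a) g))
      = \<phi> r \<odot>\<^bsub>Ann_perm S G X \<alpha>\<^esub> (\<lambda>g\<in>carrier G. \<phi> (a g))"
    if "r \<in> carrier R" "a \<in> carrier (Ann_perm R G X \<alpha>)" for r a
    using that carr[OF that(2)] by (auto simp: Ann_perm_def group_algebra_def intro!: restrict_ext)
  have tens: "base_change_map S \<phi> G X \<alpha> = tensor_lift (Ann_perm S G X \<alpha>) ?b"
    by (simp add: base_change_map_def ops)
  note lift = tensor_lift[OF module_restrict_scalars[OF R.is_cring S.is_cring \<phi>] R.module_Ann_perm
      A.abelian_group_axioms, of ?b, folded tens]
  show "base_change_map S \<phi> G X \<alpha>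
      \<in> hom (tensor_product R (restrict_scalars S \<phi>) (Ann_perm R G X \<alpha>))
            (add_monoid (Ann_perm S G X \<alpha>))"
    by (rule lift(1))
      (simp_all add: ops(1-3) img add smult A.smult_l_distr A.smult_r_distr
        A.smult_assoc1[symmetric] S.m_comm)
  show "base_change_map S \<phi> G X \<alpha> (pure_tensor R (restrict_scalars S \<phi>) (Ann_perm R G X \<alpha>) s a)
        = s \<odot>\<^bsub>group_algebra S G\<^esub> (\<lambda>g\<in>carrier G. \<phi> (a g))"
    if "s \<in> carrier S" "a \<in> carrier (Ann_perm R G X \<alpha>)"
    by (subst lift(2))
      (use that in \<open>simp_all add: ops(1-3) img add smult A.smult_l_distr A.smult_r_distr
        A.smult_assoc1[symmetric] S.m_comm\<close>, simp_all add: ops)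
qed

lemma permutation_representation_young:
  assumes "cring S"
  shows "permutation_representation S (sym_group (a + b))
    (lcosets\<^bsub>sym_group (a + b)\<^esub> (young_subgroup a b))
    (coset_action (sym_group (a + b)) (young_subgroup a b))"
proof (intro permutation_representation.intro permutation_representation_axioms.intro assms)
  show "group_action (sym_group (a + b)) (lcosets\<^bsub>sym_group (a + b)\<^esub> (young_subgroup a b))
      (coset_action (sym_group (a + b)) (young_subgroup a b))"
    by (intro coset_action_group_action sym_group_is_group young_subgroup_is_subgroup)
  show "finite (carrier (sym_group (a + b)))"
    by (simp add: sym_group_def finite_permutations)
qed

end

theory Submission
  imports Defs
begin

text \<open>
  Identify \<open>X\<close> with the two-element subsets of \<open>{1, 2, 3, 4}\<close>, and let \<open>v\<close> be the sum of those that do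
  not contain 1. For \<open>a\<close> in the group algebra, the coefficients of \<open>a \<cdot> v\<close> at \<open>{1, 2}\<close>, \<open>{1, 3}\<close>
  and \<open>{1, 4}\<close> sum to \<open>2 \<lambda>(a)\<close>, where \<open>\<lambda>(a)\<close> is the sum of the \<open>a g\<close> with \<open>g 1 \<noteq> 1\<close>. This even
  number obstructs both properties.

  Over \<open>R\<close>, where 2 is not a zero divisor, \<open>\<lambda>\<close> vanishes on the annihilator of \<open>RX\<close>, and hence on its
  image over \<open>F\<close>. But the sum of the normal Klein four-group annihilates \<open>FX\<close>, and \<open>\<lambda>\<close> takes the
  value \<open>3 = 1\<close> on it. Over \<open>F\<close>, every \<open>a \<cdot> v\<close> has coefficient sum zero at the three subsets,
  whereas the image of \<open>v\<close> under complementation of subsets, which lies in the double centraliser,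
  has coefficient sum \<open>3 = 1\<close> there.
\<close>

section \<open>Tensor products\<close>

lemma pure_tensor_closed:
  assumes "x \<in> carrier M" "y \<in> carrier N"
  shows "pure_tensor R M N x y \<in> carrier (tensor_product R M N)"
  using assms by (auto simp: pure_tensor_def tensor_product_def carrier_FactGroup)

text \<open>Pure tensors generate the tensor product as an abelian group, so a subgroup that catches
  their images catches the whole image. Below, the subgroup is the kernel of \<lambda>.\<close>

lemma tensor_product_hom_image:
  assumes M: "module R M" and N: "module R N"
    and h: "h \<in> hom (tensor_product R M N) A" and A: "group A" and H: "subgroup H A"
    and pure: "\<And>x y. \<lbrakk>x \<in> carrier M; y \<in> carrier N\<rbrakk> \<Longrightarrow> h (pure_tensor R M N x y) \<in> H"
  shows "h ` carrier (tensor_product R M N) \<subseteq> H"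
proof
  interpret M: module R M by fact
  interpret N: module R N by fact
  let ?F = "free_Abelian_group (carrier M \<times> carrier N)" and ?K = "tensor_kernel R M N"
  interpret F: comm_group ?F by (rule abelian_free_Abelian_group)
  have diff: "c - d \<in> carrier ?F" if "c \<in> carrier ?F" "d \<in> carrier ?F" for c d
    using that keys_diff[of c d] by (simp add: subset_iff) blast
  have "tensor_relations R M N \<subseteq> carrier ?F"
    unfolding tensor_relations_def
    by (intro Un_least subsetI; clarify; intro diff) auto
  then have K: "subgroup ?K ?F"
    unfolding tensor_kernel_def by (rule F.generate_is_subgroup)
  interpret K: normal ?K ?F using K by (rule F.subgroup_imp_normal)
  interpret T: group "tensor_product R M N"
    unfolding tensor_product_def by (rule K.factorgroup_is_group)
  interpret h: group_hom "tensor_product R M N" A h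
    using h A by (simp add: group_hom_def group_hom_axioms_def T.is_group)
  let ?q = "\<lambda>c. ?K #>\<^bsub>?F\<^esub> c"
  interpret q: group_hom ?F "tensor_product R M N" ?q
    using K.r_coset_hom_Mod T.is_group F.is_group
    by (simp add: group_hom_def group_hom_axioms_def tensor_product_def)
  fix z assume "z \<in> h ` carrier (tensor_product R M N)"
  then obtain c where c: "Poly_Mapping.keys c \<subseteq> carrier M \<times> carrier N" and z: "z = h (?q c)"
    by (auto simp: tensor_product_def carrier_FactGroup)
  \<comment> \<open>The bound on the keys is carried through the induction: the homomorphism laws in
    the difference case need both \<open>a\<close> and \<open>b\<close> in the free group.\<close>
  have "Poly_Mapping.keys c \<subseteq> carrier M \<times> carrier N \<and> h (?q c) \<in> H"
    using c
  proof (induction c rule: frag_induction)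
    case zero
    have "h (?q \<one>\<^bsub>?F\<^esub>) = \<one>\<^bsub>A\<^esub>" by (simp only: q.hom_one h.hom_one)
    then show ?case using subgroup.one_closed[OF H] by simp
  next
    case (one p)
    then show ?case using pure by (cases p) (simp add: pure_tensor_def)
  next
    case (diff a b)
    then have ab: "a \<in> carrier ?F" "b \<in> carrier ?F" by simp_all
    have "a - b = a \<otimes>\<^bsub>?F\<^esub> inv\<^bsub>?F\<^esub> b" using ab by simp
    then have "h (?q (a - b)) = h (?q a) \<otimes>\<^bsub>A\<^esub> inv\<^bsub>A\<^esub> h (?q b)"
      using ab by (simp only: q.hom_mult q.hom_inv q.hom_closed h.hom_mult h.hom_inv F.inv_closed
          T.inv_closed)
    then show ?case
      using diff keys_diff[of a b]
      by (auto intro!: subgroup.m_closed[OF H] subgroup.m_inv_closed[OF H])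
  qed
  then show "z \<in> H" using z by simp
qed

section \<open>Cosets of Young subgroups as subsets\<close>

text \<open>The union over the whole coset avoids choosing a representative: all members of a coset
  of the Young subgroup send \<open>{1..a}\<close> to the same set.\<close>

definition coset_points :: "nat \<Rightarrow> (nat \<Rightarrow> nat) set \<Rightarrow> nat set" where
  "coset_points a C = (\<Union>p\<in>C. p ` {1..a})"

lemma coset_points_l_coset:
  assumes "g \<in> carrier (sym_group (a + b))"
  shows "coset_points a (g <#\<^bsub>sym_group (a + b)\<^esub> young_subgroup a b) = g ` {1..a}"
proof -
  have "id \<in> young_subgroup a b"
    by (auto simp: young_subgroup_def sym_group_def permutes_id)
  moreover have "(g \<circ> p) ` {1..a} = g ` {1..a}" if "p \<in> young_subgroup a b" for p
    using that by (simp add: young_subgroup_def flip: image_image)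
  ultimately show ?thesis
    unfolding coset_points_def l_coset_def sym_group_mult by blast
qed

text \<open>This exhibits the Young subgroup as the stabiliser of \<open>{1..a}\<close>; a
  permutation that preserves one block preserves its complement.\<close>

lemma young_subgroup_iff:
  "p \<in> young_subgroup a b \<longleftrightarrow> p \<in> carrier (sym_group (a + b)) \<and> p ` {1..a} = {1..a}"
proof -
  have "p ` {a+1..a+b} = {a+1..a+b}" if p: "p permutes {1..a+b}" "p ` {1..a} = {1..a}"
  proof -
    have "{a+1..a+b} = {1..a+b} - {1..a}" by auto
    then show ?thesis
      using p by (simp add: image_set_diff permutes_inj permutes_image)
  qed
  then show ?thesis by (auto simp: young_subgroup_def sym_group_carrier)
qed

lemma coset_points_act:
  assumes g: "g \<in> carrier (sym_group (a + b))"
    and C: "C \<in> lcosets\<^bsub>sym_group (a + b)\<^esub> (young_subgroup a b)"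
  shows "coset_points a (coset_action (sym_group (a + b)) (young_subgroup a b) g C)
    = g ` coset_points a C"
  using g C by (auto simp: coset_points_def coset_action_def l_coset_def sym_group_def)

text \<open>A bijection from \<open>B\<close> to \<open>C\<close> is glued to one between the
  complements. This gives transitivity on subsets of a fixed size.\<close>

lemma ex_permutes_image:
  assumes "finite A" "B \<subseteq> A" "C \<subseteq> A" "card B = card C"
  shows "\<exists>p. p permutes A \<and> p ` B = C"
proof -
  have fin: "finite B" "finite C" using assms finite_subset by blast+
  obtain f where f: "bij_betw f B C"
    using finite_same_card_bij[OF fin assms(4)] by blast
  have "card (A - B) = card (A - C)" using assms fin by (simp add: card_Diff_subset)
  then obtain f' where f': "bij_betw f' (A - B) (A - C)"
    using finite_same_card_bij[of "A - B" "A - C"] assms(1) by blast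
  define p where "p x = (if x \<in> B then f x else if x \<in> A then f' x else x)" for x
  have p: "bij_betw p B C" "bij_betw p (A - B) (A - C)"
    using f f' by (auto simp: p_def bij_betw_def inj_on_def image_iff)
  then have "bij_betw p (B \<union> (A - B)) (C \<union> (A - C))"
    by (rule bij_betw_combine) auto
  moreover have "B \<union> (A - B) = A" "C \<union> (A - C) = A" using assms by auto
  ultimately have "bij_betw p A A" by simp
  then have "p permutes A"
    using assms(2) by (auto intro!: bij_imp_permutes simp: p_def)
  then show ?thesis using p(1) by (auto simp: bij_betw_def)
qed

text \<open>Orbit-stabiliser: the symmetric group is transitive on subsets of size \<open>a\<close>,
  and the Young subgroup is the stabiliser of \<open>{1..a}\<close>.\<close>

lemma bij_betw_coset_points:
  "bij_betw (coset_points a) (lcosets\<^bsub>sym_group (a + b)\<^esub> (young_subgroup a b))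
     {x. x \<subseteq> {1..a+b} \<and> card x = a}"
proof -
  let ?G = "sym_group (a + b)" and ?H = "young_subgroup a b"
  interpret group ?G by (rule sym_group_is_group)
  have H: "subgroup ?H ?G" by (rule young_subgroup_is_subgroup)
  have X: "lcosets\<^bsub>?G\<^esub> ?H = (\<lambda>g. g <#\<^bsub>?G\<^esub> ?H) ` carrier ?G" by (auto simp: LCOSETS_def)
  have "inj_on (coset_points a) (lcosets\<^bsub>?G\<^esub> ?H)"
  proof (rule inj_onI)
    fix C D assume "C \<in> lcosets\<^bsub>?G\<^esub> ?H" "D \<in> lcosets\<^bsub>?G\<^esub> ?H" "coset_points a C = coset_points a D"
    then obtain g h where gh: "g \<in> carrier ?G" "h \<in> carrier ?G" "C = g <#\<^bsub>?G\<^esub> ?H" "D = h <#\<^bsub>?G\<^esub> ?H"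
      and eq: "g ` {1..a} = h ` {1..a}"
      unfolding X by (auto simp: coset_points_l_coset)
    let ?k = "inv\<^bsub>?G\<^esub> h \<otimes>\<^bsub>?G\<^esub> g"
    have k: "?k \<in> carrier ?G" using gh(1,2) by (intro m_closed inv_closed)
    have g: "g = h \<otimes>\<^bsub>?G\<^esub> ?k" using gh(1,2) by (metis inv_closed l_one m_assoc r_inv)
    then have "h ` ?k ` {1..a} = h ` {1..a}"
      using eq by (metis image_comp sym_group_mult)
    moreover have "inj h" using gh by (simp add: sym_group_carrier permutes_inj)
    ultimately have "?k \<in> ?H" using k by (simp add: young_subgroup_iff inj_image_eq_iff)
    then have "g \<in> h <#\<^bsub>?G\<^esub> ?H" using g by (force simp: l_coset_def)
    then show "C = D"
      using l_repr_independence[OF _ gh(2) H] gh by simp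
  qed
  moreover have "coset_points a ` (lcosets\<^bsub>?G\<^esub> ?H) = (\<lambda>g. g ` {1..a}) ` carrier ?G"
    unfolding X image_image by (intro image_cong refl coset_points_l_coset)
  moreover have "(\<lambda>g. g ` {1..a}) ` carrier ?G = {x. x \<subseteq> {1..a+b} \<and> card x = a}"
  proof (intro equalityI subsetI)
    fix x assume "x \<in> (\<lambda>g. g ` {1..a}) ` carrier ?G"
    then obtain g where g: "g permutes {1..a+b}" "x = g ` {1..a}"
      by (auto simp: sym_group_carrier)
    then have "card x = card {1..a}" by (metis card_image inj_on_subset permutes_inj subset_UNIV)
    moreover have "x \<subseteq> g ` {1..a+b}" unfolding g(2) by (intro image_mono) auto
    ultimately show "x \<in> {x. x \<subseteq> {1..a+b} \<and> card x = a}"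
      using permutes_image[OF g(1)] by simp
  next
    fix x assume "x \<in> {x. x \<subseteq> {1..a+b} \<and> card x = a}"
    then obtain p where "p permutes {1..a+b}" "p ` {1..a} = x"
      using ex_permutes_image[of "{1..a+b}" "{1..a}" x] by auto
    then show "x \<in> (\<lambda>g. g ` {1..a}) ` carrier ?G" by (auto simp: sym_group_carrier)
  qed
  ultimately show ?thesis by (simp add: bij_betw_def)
qed

section \<open>The Klein four-group on two-element subsets\<close>

definition double_transposition :: "nat \<Rightarrow> nat \<Rightarrow> nat \<Rightarrow> nat \<Rightarrow> nat \<Rightarrow> nat" where
  "double_transposition i j k l = transpose i j \<circ> transpose k l"

definition klein_four :: "(nat \<Rightarrow> nat) set" where
  "klein_four = {id, double_transposition 1 2 3 4, double_transposition 1 3 2 4,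
     double_transposition 1 4 2 3}"

abbreviation two_subsets :: "nat set set" where
  "two_subsets \<equiv> {x. x \<subseteq> {1..4} \<and> card x = 2}"

lemma two_subsets_eq:
  "two_subsets = {{1,2},{1,3},{1,4},{2,3},{2,4},{3,4}}"
proof (intro equalityI subsetI)
  fix x :: "nat set" assume "x \<in> two_subsets"
  then obtain i j where x: "x = {i, j}" "i \<noteq> j" and "i \<in> {1..4}" "j \<in> {1..4}"
    by (auto simp: card_2_iff)
  then have "i \<in> {1,2,3,4}" "j \<in> {1,2,3,4}" by auto
  then show "x \<in> {{1,2},{1,3},{1,4},{2,3},{2,4},{3,4}}"
    using x by (auto simp: insert_commute)
qed auto

lemma complement_two_subsets:
  "{1..4} - {1,2} = {3,4::nat}" "{1..4} - {1,3} = {2,4::nat}" "{1..4} - {1,4} = {2,3::nat}"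
  "{1..4} - {2,3} = {1,4::nat}" "{1..4} - {2,4} = {1,3::nat}" "{1..4} - {3,4} = {1,2::nat}"
  by auto

lemma klein_four_subset: "klein_four \<subseteq> carrier (sym_group 4)"
  by (auto simp: klein_four_def double_transposition_def sym_group_carrier permutes_id
      intro!: permutes_compose permutes_swap_id)

lemma klein_four_invol: "k \<in> klein_four \<Longrightarrow> k \<circ> k = id"
  by (auto simp: klein_four_def double_transposition_def transpose_def fun_eq_iff)

lemma klein_four_inv: "k \<in> klein_four \<Longrightarrow> inv\<^bsub>sym_group 4\<^esub> k = k"
  using klein_four_subset klein_four_invol
  by (intro group.inv_equality[OF sym_group_is_group]) (auto simp: sym_group_def)

text \<open>The six pairs form three complementary couples. Each double transposition fixes the
  pairs of one couple and complements all others. Two pairs meet at most two couples, so the double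
  transposition belonging to a remaining couple complements both.\<close>

lemma klein_four_complement:
  assumes "x \<in> two_subsets" "y \<in> two_subsets"
  shows "\<exists>k\<in>klein_four. k ` x = {1..4} - x \<and> k ` y = {1..4} - y"
  using assms unfolding two_subsets_eq klein_four_def double_transposition_def
  by (elim insertE emptyE; hypsubst_thin; unfold complement_two_subsets;
      simp add: transpose_def insert_commute doubleton_eq_iff)


text \<open>Otherwise the simplifier turns \<open>inv\<^bsub>sym_group 4\<^esub> g\<close> into the inverse function of \<open>g\<close>, and the
  facts of the locale no longer match.\<close>

declare sym_group_inv_equality [simp del]

section \<open>Permutation modules on two-element subsets\<close>

text \<open>The set \<open>X\<close> stays abstract, with an equivariant labelling by pairs, so that
  computations take place on pairs instead of cosets and apply over both \<open>R\<close> and its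
  residue field.\<close>

locale pair_representation = permutation_representation S "sym_group 4" X \<alpha>
  for S :: "('s, 'm) ring_scheme" (structure) and X :: "'x set" and \<alpha> +
  fixes pts :: "'x \<Rightarrow> nat set"
  assumes bij_pts: "bij_betw pts X two_subsets"
    and pts_act: "\<lbrakk>g \<in> carrier (sym_group 4); x \<in> X\<rbrakk> \<Longrightarrow> pts (\<alpha> g x) = g ` pts x"
begin

abbreviation G where "G \<equiv> sym_group 4"
abbreviation SG where "SG \<equiv> group_algebra S G"
abbreviation SX where "SX \<equiv> perm_module S G X \<alpha>"

definition pt :: "nat set \<Rightarrow> 'x" where "pt = inv_into X pts"

lemma pt_closed [simp]: "p \<in> two_subsets \<Longrightarrow> pt p \<in> X"
  unfolding pt_def using bij_pts by (metis bij_betw_imp_surj_on inv_into_into)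

lemma pts_pt [simp]: "p \<in> two_subsets \<Longrightarrow> pts (pt p) = p"
  unfolding pt_def using bij_pts by (metis bij_betw_inv_into_right)

lemma pt_pts [simp]: "x \<in> X \<Longrightarrow> pt (pts x) = x"
  unfolding pt_def using bij_pts by (metis bij_betw_inv_into_left)

lemma pts_closed: "x \<in> X \<Longrightarrow> pts x \<in> two_subsets"
  using bij_pts by (metis bij_betwE)

lemma act_eq: "\<lbrakk>g \<in> carrier G; x \<in> X\<rbrakk> \<Longrightarrow> \<alpha> g x = pt (g ` pts x)"
  by (metis act_closed pt_pts pts_act)

lemma finite_X: "finite X"
  using bij_betw_finite[OF bij_pts] by (simp add: two_subsets_eq)

section \<open>The functional \<lambda> and the evenness of coefficient sums\<close>

definition avoid_one :: "'x \<Rightarrow> 's" where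
  "avoid_one = (\<lambda>x\<in>X. if 1 \<in> pts x then \<zero> else \<one>)"

lemma avoid_one_closed: "avoid_one \<in> carrier SX"
  by (simp add: avoid_one_def perm_module_def)

definition sum_at_one :: "('x \<Rightarrow> 's) \<Rightarrow> 's" where
  "sum_at_one v = v (pt {1,2}) \<oplus> v (pt {1,3}) \<oplus> v (pt {1,4})"

text \<open>This is the functional \<lambda>.\<close>

definition moved_sum :: "((nat \<Rightarrow> nat) \<Rightarrow> 's) \<Rightarrow> 's" where
  "moved_sum a = (\<Oplus>g\<in>carrier G. a g \<otimes> (if g 1 = 1 then \<zero> else \<one>))"

lemma act_avoid_one:
  assumes "g \<in> carrier G" "p \<in> two_subsets"
  shows "avoid_one (\<alpha> g (pt p)) = (if 1 \<in> g ` p then \<zero> else \<one>)"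
  using assms by (simp add: avoid_one_def pts_act)

text \<open>Each \<open>g\<close> with \<open>g 1 \<noteq> 1\<close> contributes at exactly two of the three sets \<open>{1, j}\<close>: the preimage
  of \<open>1\<close> under \<open>g\<inverse>\<close> is one of the three \<open>j\<close>.\<close>

lemma sum_at_one_smult_avoid_one:
  assumes "a \<in> carrier SG"
  shows "sum_at_one (a \<odot>\<^bsub>SX\<^esub> avoid_one) = moved_sum a \<oplus> moved_sum a"
proof -
  have a [simp]: "a g \<in> carrier S" if "g \<in> carrier G" for g
    using assms that by (auto simp: group_algebra_def)
  let ?f = "\<lambda>p g. a g \<otimes> (if 1 \<in> (inv\<^bsub>G\<^esub> g) ` p then \<zero> else \<one>)"
  let ?m = "\<lambda>g. a g \<otimes> (if g 1 = 1 then \<zero> else \<one>)"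
  have val: "(a \<odot>\<^bsub>SX\<^esub> avoid_one) (pt p) = (\<Oplus>g\<in>carrier G. ?f p g)" if "p \<in> two_subsets" for p
    using that by (simp add: perm_module_def act_avoid_one cong: finsum_cong)
  have tw: "{1,2} \<in> two_subsets" "{1,3} \<in> two_subsets" "{1,4} \<in> two_subsets" by auto
  have eq: "?f {1,2} g \<oplus> ?f {1,3} g \<oplus> ?f {1,4} g = ?m g \<oplus> ?m g" if g: "g \<in> carrier G" for g
  proof -
    define h where "h = inv\<^bsub>G\<^esub> g"
    have h: "h permutes {1..4}" using g Grp.inv_closed[of g] by (simp add: h_def sym_group_carrier)
    have gh: "g \<circ> h = id" using g Grp.r_inv[of g] by (simp add: h_def sym_group_def)
    have hg: "h \<circ> g = id" using g Grp.l_inv[of g] by (simp add: h_def sym_group_def)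
    define j where "j = g 1"
    have hj: "h i = 1 \<longleftrightarrow> i = j" for i
      using gh hg unfolding j_def by (metis comp_apply id_apply)
    have "j \<in> {1..4}" using g permutes_in_image[of g "{1..4}" 1] by (simp add: j_def sym_group_carrier)
    \<comment> \<open>If \<open>j = 1\<close>, all three pairs contain \<open>j\<close> and both
      sides vanish; otherwise exactly one pair contains \<open>j\<close>, and the other two
      contribute \<open>a g\<close> each.\<close>
    then have "j = 1 \<or> j = 2 \<or> j = 3 \<or> j = 4" by auto
    moreover have "1 \<in> h ` {i, k} \<longleftrightarrow> i = j \<or> k = j" for i k
      using hj by (metis image_insert image_empty insert_iff empty_iff)
    ultimately show ?thesis
      using g unfolding h_def[symmetric] j_def[symmetric] by (elim disjE) simp_all
  qed
  have cl: "?f p \<in> carrier G \<rightarrow> carrier S" "?m \<in> carrier G \<rightarrow> carrier S" for p by auto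
  have "sum_at_one (a \<odot>\<^bsub>SX\<^esub> avoid_one) = (\<Oplus>g\<in>carrier G. ?f {1,2} g \<oplus> ?f {1,3} g \<oplus> ?f {1,4} g)"
    using tw cl by (simp add: sum_at_one_def val finsum_addf)
  also have "\<dots> = (\<Oplus>g\<in>carrier G. ?m g \<oplus> ?m g)"
    by (intro finsum_eqI eq) auto
  also have "\<dots> = moved_sum a \<oplus> moved_sum a"
    unfolding moved_sum_def using cl(2) by (intro finsum_addf)
  finally show ?thesis .
qed

lemma moved_sum_closed [simp]: "a \<in> carrier SG \<Longrightarrow> moved_sum a \<in> carrier S"
  unfolding moved_sum_def by (intro finsum_closed) (auto simp: group_algebra_def)

lemma moved_sum_hom: "moved_sum \<in> hom (add_monoid SG) (add_monoid S)"
proof (rule homI)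
  fix a b assume ab: "a \<in> carrier (add_monoid SG)" "b \<in> carrier (add_monoid SG)"
  then have "a \<in> carrier G \<rightarrow> carrier S" "b \<in> carrier G \<rightarrow> carrier S"
    by (auto simp: group_algebra_def)
  then have "(\<Oplus>g\<in>carrier G. (a g \<oplus> b g) \<otimes> (if g 1 = 1 then \<zero> else \<one>)) = moved_sum a \<oplus> moved_sum b"
    unfolding moved_sum_def by (intro finsum_l_distr) auto
  moreover have "(\<Oplus>g\<in>carrier G. (a \<oplus>\<^bsub>SG\<^esub> b) g \<otimes> (if g 1 = 1 then \<zero> else \<one>))
      = (\<Oplus>g\<in>carrier G. (a g \<oplus> b g) \<otimes> (if g 1 = 1 then \<zero> else \<one>))"
    using ab by (intro finsum_eqI) (auto simp: group_algebra_def)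
  ultimately show "moved_sum (a \<otimes>\<^bsub>add_monoid SG\<^esub> b) = moved_sum a \<otimes>\<^bsub>add_monoid S\<^esub> moved_sum b"
    by (simp add: moved_sum_def)
qed simp

text \<open>Applying \<open>a\<close> to \<open>avoid_one\<close> yields only 2 \<lambda>(a) = 0.
  Cancelling the 2 is the step that separates \<open>R\<close> from its residue field.\<close>

lemma moved_sum_annihilator:
  assumes "domain S" and "\<one> \<oplus> \<one> \<noteq> \<zero>" and a: "a \<in> annihilator SG SX"
  shows "moved_sum a = \<zero>"
proof -
  interpret domain S by fact
  have aG: "a \<in> carrier SG" using a by (simp add: annihilator_def)
  have "a \<odot>\<^bsub>SX\<^esub> avoid_one = \<zero>\<^bsub>SX\<^esub>"
    using a avoid_one_closed by (simp add: annihilator_def)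
  moreover have "sum_at_one \<zero>\<^bsub>SX\<^esub> = \<zero>"
    using pt_closed by (simp add: sum_at_one_def perm_module_def)
  ultimately have "moved_sum a \<oplus> moved_sum a = \<zero>"
    using sum_at_one_smult_avoid_one[OF aG] by simp
  then have "(\<one> \<oplus> \<one>) \<otimes> moved_sum a = \<zero>"
    using aG by (simp add: l_distr)
  then show ?thesis
    using assms(2) aG integral[of "\<one> \<oplus> \<one>" "moved_sum a"] by auto
qed

section \<open>The Klein four-group sum in the annihilator\<close>

definition klein_element :: "(nat \<Rightarrow> nat) \<Rightarrow> 's" where
  "klein_element = (\<lambda>g\<in>carrier G. if g \<in> klein_four then \<one> else \<zero>)"

lemma klein_element_closed: "klein_element \<in> carrier SG"
  by (simp add: klein_element_def group_algebra_def)

lemma finsum_klein_element: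
  assumes "f \<in> carrier G \<rightarrow> carrier S"
  shows "(\<Oplus>g\<in>carrier G. klein_element g \<otimes> f g) = f id \<oplus> f (double_transposition 1 2 3 4)
    \<oplus> f (double_transposition 1 3 2 4) \<oplus> f (double_transposition 1 4 2 3)"
proof -
  have f [simp]: "f g \<in> carrier S" if "g \<in> klein_four" for g
    using assms klein_four_subset that by auto
  have "(\<Oplus>g\<in>carrier G. klein_element g \<otimes> f g) = (\<Oplus>g\<in>klein_four. f g)"
    using assms klein_four_subset
    by (intro add.finprod_mono_neutral_cong_right) (auto simp: klein_element_def Pi_iff)
  moreover have "f id \<in> carrier S" "f (double_transposition 1 2 3 4) \<in> carrier S"
    "f (double_transposition 1 3 2 4) \<in> carrier S" "f (double_transposition 1 4 2 3) \<in> carrier S"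
    by (simp_all add: klein_four_def)
  moreover have "distinct [id, double_transposition 1 2 3 4, double_transposition 1 3 2 4,
     double_transposition 1 4 2 3]"
    by (auto simp: double_transposition_def transpose_def fun_eq_iff)
  ultimately show ?thesis
    by (simp add: klein_four_def a_assoc)
qed

text \<open>Each of the three double transpositions moves 1, and the identity does not.\<close>

lemma moved_sum_klein_element: "moved_sum klein_element = \<one> \<oplus> \<one> \<oplus> \<one>"
  unfolding moved_sum_def
  by (subst finsum_klein_element) (auto simp: double_transposition_def transpose_def)

text \<open>Each pair is fixed by the identity and one double transposition, and complemented by the
  other two. Every coefficient of the product is thus a sum of two doubled terms.\<close>

lemma klein_element_annihilator:
  assumes two: "\<one> \<oplus> \<one> = \<zero>"
  shows "klein_element \<in> annihilator SG SX"
proof -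
  have char2: "r \<oplus> r = \<zero>" if "r \<in> carrier S" for r
    using that two l_distr[of \<one> \<one> r] by simp
  have sum: "(\<Oplus>g\<in>carrier G. klein_element g \<otimes> v (\<alpha> (inv\<^bsub>G\<^esub> g) x)) = \<zero>"
    if v: "v \<in> carrier SX" and x: "x \<in> X" for v x
  proof -
    have vX [simp]: "v y \<in> carrier S" if "y \<in> X" for y
      using v that by (auto simp: perm_module_def)
    define w where "w p = v (pt p)" for p
    have w: "w p \<in> carrier S" if "p \<in> two_subsets" for p
      using that by (simp add: w_def)
    have val: "v (\<alpha> (inv\<^bsub>G\<^esub> k) x) = w (k ` pts x)" if "k \<in> klein_four" for k
      using that x klein_four_subset by (simp add: klein_four_inv act_eq w_def subset_iff)
    have kf: "id \<in> klein_four" "double_transposition 1 2 3 4 \<in> klein_four"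
      "double_transposition 1 3 2 4 \<in> klein_four" "double_transposition 1 4 2 3 \<in> klein_four"
      by (simp_all add: klein_four_def)
    have cl: "w {1,2} \<in> carrier S" "w {1,3} \<in> carrier S" "w {1,4} \<in> carrier S"
      "w {2,3} \<in> carrier S" "w {2,4} \<in> carrier S" "w {3,4} \<in> carrier S"
      by (intro w; simp)+
    \<comment> \<open>The order of the four terms depends on which double transposition fixes the
      pair, hence three arrangements.\<close>
    have pair: "r \<oplus> r \<oplus> s \<oplus> s = \<zero>" "r \<oplus> s \<oplus> r \<oplus> s = \<zero>" "r \<oplus> s \<oplus> s \<oplus> r = \<zero>"
      if "r \<in> carrier S" "s \<in> carrier S" for r s
    proof -
      show *: "r \<oplus> r \<oplus> s \<oplus> s = \<zero>" using that by (simp add: char2)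
      then show "r \<oplus> s \<oplus> r \<oplus> s = \<zero>" "r \<oplus> s \<oplus> s \<oplus> r = \<zero>"
        using that by (simp_all add: a_ac)
    qed
    have "(\<Oplus>g\<in>carrier G. klein_element g \<otimes> v (\<alpha> (inv\<^bsub>G\<^esub> g) x))
        = w (id ` pts x) \<oplus> w (double_transposition 1 2 3 4 ` pts x)
          \<oplus> w (double_transposition 1 3 2 4 ` pts x) \<oplus> w (double_transposition 1 4 2 3 ` pts x)"
      using x by (subst finsum_klein_element) (simp_all only: kf[THEN val], simp add: Pi_iff)
    also have "\<dots> = \<zero>"
      using pts_closed[OF x] pair cl unfolding two_subsets_eq double_transposition_def
      by (elim insertE emptyE) (simp_all add: transpose_def insert_commute)
    finally show ?thesis .
  qed
  have "klein_element \<odot>\<^bsub>SX\<^esub> v = \<zero>\<^bsub>SX\<^esub>" if "v \<in> carrier SX" for v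
    using sum[OF that] by (auto simp: perm_module_def intro!: restrict_ext)
  then show ?thesis
    using klein_element_closed by (simp add: annihilator_def)
qed

section \<open>Complementation in the double centraliser\<close>

text \<open>Complementation is an involution, so precomposing with it is the linear extension of
  complementing basis elements.\<close>

definition compl_map :: "('x \<Rightarrow> 's) \<Rightarrow> 'x \<Rightarrow> 's" where
  "compl_map = (\<lambda>v\<in>carrier SX. \<lambda>x\<in>X. v (pt ({1..4} - pts x)))"

lemma complement_closed: "p \<in> two_subsets \<Longrightarrow> {1..4} - p \<in> two_subsets"
  by (auto simp: card_Diff_subset finite_subset[of p "{1..4}"])

lemma compl_map_additive_End: "compl_map \<in> additive_End SX"
proof -
  have "pt ({1..4} - pts x) \<in> X" if "x \<in> X" for x
    using pt_closed[OF complement_closed[OF pts_closed[OF that]]] .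
  then show ?thesis
    by (auto simp: additive_End_def compl_map_def hom_def perm_module_def intro!: restrict_ext)
qed

text \<open>The scalar \<open>s\<close> is built in because the maps compared on these vectors are
  only assumed additive.\<close>

definition delta :: "'x \<Rightarrow> 's \<Rightarrow> 'x \<Rightarrow> 's" where
  "delta y s = (\<lambda>z\<in>X. if z = y then s else \<zero>)"

lemma delta_closed: "s \<in> carrier S \<Longrightarrow> delta y s \<in> carrier SX"
  by (simp add: delta_def perm_module_def)

text \<open>As \<open>X\<close> is finite, the vectors \<open>delta y s\<close> generate
  \<open>SX\<close> additively. The proof is by induction on a finite set containing the support,
  splitting off one coefficient at a time.\<close>

lemma additive_eq_on_delta:
  assumes f: "f \<in> hom (add_monoid SX) (add_monoid SX)"
    and h: "h \<in> hom (add_monoid SX) (add_monoid SX)"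
    and delta: "\<And>y s. \<lbrakk>y \<in> X; s \<in> carrier S\<rbrakk> \<Longrightarrow> f (delta y s) = h (delta y s)"
    and v: "v \<in> carrier SX"
  shows "f v = h v"
proof -
  interpret P: abelian_group SX by (rule abelian_group_perm_module)
  interpret f: group_hom "add_monoid SX" "add_monoid SX" f
    using f by (simp add: group_hom_def group_hom_axioms_def P.a_group)
  interpret h: group_hom "add_monoid SX" "add_monoid SX" h
    using h by (simp add: group_hom_def group_hom_axioms_def P.a_group)
  have "f v = h v" if "finite Y" "Y \<subseteq> X" "v \<in> carrier SX" "\<forall>x\<in>X - Y. v x = \<zero>" for Y v
    using that
  proof (induction Y arbitrary: v rule: finite_induct)
    case empty
    then have "v \<in> extensional X" by (simp add: perm_module_def PiE_def)
    then have "v = \<zero>\<^bsub>SX\<^esub>"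
      by (rule extensionalityI) (use empty in \<open>auto simp: perm_module_def\<close>)
    then show ?case using f.hom_one h.hom_one by simp
  next
    case (insert y Y)
    have vX: "v x \<in> carrier S" if "x \<in> X" for x
      using insert.prems that by (auto simp: perm_module_def)
    define w where "w = (\<lambda>x\<in>X. if x = y then \<zero> else v x)"
    have w: "w \<in> carrier SX" using vX by (simp add: w_def perm_module_def)
    have vy: "v y \<in> carrier S" using vX insert.prems by simp
    have "v \<in> extensional X" using insert.prems by (simp add: perm_module_def PiE_def)
    then have v: "v = w \<oplus>\<^bsub>SX\<^esub> delta y (v y)"
      by (rule extensionalityI[where A = X]) (auto simp: perm_module_def w_def delta_def vX)
    have "f w = h w" using insert.prems by (intro insert.IH w) (auto simp: w_def)
    moreover have "f (delta y (v y)) = h (delta y (v y))" using insert.prems vy by (intro delta) auto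
    ultimately show ?case
      using v w delta_closed[OF vy] f.hom_mult[of w "delta y (v y)"] h.hom_mult[of w "delta y (v y)"]
      by simp
  qed
  from this[OF finite_X _ v] show ?thesis by simp
qed

definition group_element :: "(nat \<Rightarrow> nat) \<Rightarrow> (nat \<Rightarrow> nat) \<Rightarrow> 's" where
  "group_element g = (\<lambda>h\<in>carrier G. if h = g then \<one> else \<zero>)"

lemma group_element_closed: "group_element g \<in> carrier SG"
  by (simp add: group_element_def group_algebra_def)

lemma group_element_smult:
  assumes "g \<in> carrier G" "v \<in> carrier SX" "x \<in> X"
  shows "(group_element g \<odot>\<^bsub>SX\<^esub> v) x = v (\<alpha> (inv\<^bsub>G\<^esub> g) x)"
proof -
  have v: "(\<lambda>h. v (\<alpha> (inv\<^bsub>G\<^esub> h) x)) \<in> carrier G \<rightarrow> carrier S"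
    using assms by (auto simp: perm_module_def)
  show ?thesis
    using assms(3) finsum_delta[OF assms(1) v] funcset_mem[OF v]
    by (simp add: perm_module_def group_element_def cong: finsum_cong)
qed

text \<open>Complementation is not the action of a single group element, but any two given pairs are
  complemented by a common element of the Klein four-group; this suffices to commute with
  all endomorphisms.\<close>

lemma compl_map_DEnd: "compl_map \<in> DEnd SG SX"
proof -
  have "compl_map (e v) = e (compl_map v)" if e: "e \<in> module_End SG SX" and v: "v \<in> carrier SX" for e v
  proof -
    have eh: "e \<in> hom (add_monoid SX) (add_monoid SX)"
      using e by (simp add: module_End_def additive_End_def)
    have ch: "compl_map \<in> hom (add_monoid SX) (add_monoid SX)"
      using compl_map_additive_End by (simp add: additive_End_def)
    have ecl: "e u \<in> carrier SX" if "u \<in> carrier SX" for u using eh that by (auto simp: hom_def)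
    have ccl: "compl_map u \<in> carrier SX" if "u \<in> carrier SX" for u using ch that by (auto simp: hom_def)
    have ext: "u \<in> extensional X" if "u \<in> carrier SX" for u
      using that by (simp add: perm_module_def PiE_def)
    have "compl_map (e (delta y s)) = e (compl_map (delta y s))" if y: "y \<in> X" and s: "s \<in> carrier S" for y s
    proof (rule extensionalityI[where A = X])
      note d = delta_closed[OF s, of y]
      show "compl_map (e (delta y s)) \<in> extensional X" "e (compl_map (delta y s)) \<in> extensional X"
        by (intro ext ecl ccl d)+
      fix x assume x: "x \<in> X"
      \<comment> \<open>The same \<open>k\<close> serves the support point \<open>y\<close> and the
        evaluation point \<open>x\<close>: at \<open>y\<close> it turns \<open>compl_map\<close>
        into the action of \<open>k\<close>, which commutes with \<open>e\<close>; at
        \<open>x\<close> it turns that action back into \<open>compl_map\<close>.\<close>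
      obtain k where k: "k \<in> klein_four" "k ` pts x = {1..4} - pts x" "k ` pts y = {1..4} - pts y"
        using klein_four_complement[OF pts_closed[OF x] pts_closed[OF y]] by blast
      have kG: "k \<in> carrier G" using k klein_four_subset by blast
      have kinv: "inv\<^bsub>G\<^esub> k = k" by (rule klein_four_inv) fact
      have kk: "k ` k ` p = p" for p using klein_four_invol[OF k(1)] by (simp add: image_comp)
      \<comment> \<open>Equality holds at every \<open>z\<close>, although \<open>k\<close> need not
        complement \<open>pts z\<close>: both sides are supported only at the complement of
        \<open>y\<close>.\<close>
      have "compl_map (delta y s) = group_element k \<odot>\<^bsub>SX\<^esub> delta y s"
      proof (rule extensionalityI[where A = X])
        show "compl_map (delta y s) \<in> extensional X" by (intro ext ccl d)
        show "group_element k \<odot>\<^bsub>SX\<^esub> delta y s \<in> extensional X" by (simp add: perm_module_def)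
        fix z assume z: "z \<in> X"
        have pz: "{1..4} - pts z \<in> two_subsets" by (intro complement_closed pts_closed z)
        have "{1..4} - pts z = pts y \<longleftrightarrow> pts z = {1..4} - pts y"
          using pts_closed[OF z] pts_closed[OF y] by blast
        also have "\<dots> \<longleftrightarrow> k ` pts z = pts y"
          using k(3) kk by metis
        finally have "pt ({1..4} - pts z) = y \<longleftrightarrow> \<alpha> k z = y"
          using y z pz kG by (metis pts_pt pt_pts pts_act act_closed)
        then show "compl_map (delta y s) z = (group_element k \<odot>\<^bsub>SX\<^esub> delta y s) z"
          using d z pt_closed[OF pz] kG kinv by (simp add: group_element_smult compl_map_def) 
            (simp add: delta_def)
      qed
      then have "e (compl_map (delta y s)) = group_element k \<odot>\<^bsub>SX\<^esub> e (delta y s)"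
        using e d group_element_closed by (simp add: module_End_def)
      then show "compl_map (e (delta y s)) x = e (compl_map (delta y s)) x"
        using kG kinv x k(2) ecl[OF d] by (simp add: group_element_smult compl_map_def act_eq)
    qed
    moreover have "compl_map \<circ> e \<in> hom (add_monoid SX) (add_monoid SX)"
      "e \<circ> compl_map \<in> hom (add_monoid SX) (add_monoid SX)"
      using eh ch by (auto intro: Group.hom_compose)
    ultimately show ?thesis
      using additive_eq_on_delta[of "compl_map \<circ> e" "e \<circ> compl_map" v] v by simp
  qed
  then show ?thesis
    using compl_map_additive_End by (simp add: DEnd_def)
qed

lemma not_double_centraliser_property:
  assumes two: "\<one> \<oplus> \<one> = \<zero>" and one: "\<one> \<noteq> \<zero>"
  shows "\<not> double_centraliser_property SG SX"
proof
  assume "double_centraliser_property SG SX"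
  then have "compl_map \<in> natural_action SX ` carrier SG"
    using compl_map_DEnd by (simp add: double_centraliser_property_def)
  then obtain a where a: "a \<in> carrier SG" "compl_map = natural_action SX a" by blast
  have "compl_map avoid_one = a \<odot>\<^bsub>SX\<^esub> avoid_one"
    using a avoid_one_closed by (simp add: natural_action_def)
  then have "sum_at_one (compl_map avoid_one) = moved_sum a \<oplus> moved_sum a"
    using sum_at_one_smult_avoid_one a by simp
  also have "\<dots> = \<zero>"
    using two a l_distr[of \<one> \<one> "moved_sum a"] by simp
  finally have "sum_at_one (compl_map avoid_one) = \<zero>" .
  \<comment> \<open>The complement of a pair through 1 avoids 1, so the coefficient sum is 1 + 1 + 1
    = 1 in characteristic 2.\<close>
  moreover have "compl_map avoid_one (pt p) = \<one>" if "p \<in> two_subsets" "1 \<in> p" for p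
    using that complement_closed[OF that(1)] avoid_one_closed
    by (simp add: compl_map_def avoid_one_def)
  ultimately show False
    using two one by (simp add: sum_at_one_def)
qed

end

section \<open>Failure of surjectivity of the base change map\<close>

lemma not_annihilator_base_change_property:
  assumes R: "pair_representation R X \<alpha> pts" and S: "pair_representation S X \<alpha> pts"
    and \<phi>: "\<phi> \<in> ring_hom R S" and "domain R" and "\<one>\<^bsub>R\<^esub> \<oplus>\<^bsub>R\<^esub> \<one>\<^bsub>R\<^esub> \<noteq> \<zero>\<^bsub>R\<^esub>"
    and two: "\<one>\<^bsub>S\<^esub> \<oplus>\<^bsub>S\<^esub> \<one>\<^bsub>S\<^esub> = \<zero>\<^bsub>S\<^esub>" and one: "\<one>\<^bsub>S\<^esub> \<noteq> \<zero>\<^bsub>S\<^esub>"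
  shows "\<not> annihilator_base_change_property R S \<phi> (sym_group 4) X \<alpha>"
proof
  interpret R: pair_representation R X \<alpha> pts by fact
  interpret S: pair_representation S X \<alpha> pts by fact
  interpret ring_hom_cring R S \<phi>
    by (intro ring_hom_cring.intro ring_hom_cring_axioms.intro R.is_cring S.is_cring \<phi>)
  let ?G = "sym_group 4"
  let ?M = "restrict_scalars S \<phi>" and ?N = "Ann_perm R ?G X \<alpha>" and ?A = "Ann_perm S ?G X \<alpha>"
  let ?\<beta> = "base_change_map S \<phi> ?G X \<alpha>"
  interpret A: module S ?A by (rule S.module_Ann_perm)
  note \<beta> = base_change_map[OF R.permutation_representation_axioms
      S.permutation_representation_axioms \<phi>]
  have AG: "carrier ?A \<subseteq> carrier (group_algebra S ?G)" by (auto simp: Ann_perm_def annihilator_def)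
  have "S.moved_sum \<in> hom (add_monoid ?A) (add_monoid S)"
    using S.moved_sum_hom AG by (auto simp: hom_def Ann_perm_def)
  then interpret m: group_hom "add_monoid ?A" "add_monoid S" S.moved_sum
    by (simp add: group_hom_def group_hom_axioms_def A.a_group S.a_group)
  let ?H = "kernel (add_monoid ?A) (add_monoid S) S.moved_sum"
  have pure: "?\<beta> (pure_tensor R ?M ?N s a) \<in> ?H" if s: "s \<in> carrier ?M" and a: "a \<in> carrier ?N" for s a
  proof -
    have s': "s \<in> carrier S" using s by (simp add: restrict_scalars_def)
    have a': "a \<in> annihilator (group_algebra R ?G) (perm_module R ?G X \<alpha>)"
      using a by (simp add: Ann_perm_def)
    have [simp]: "a g \<in> carrier R" if "g \<in> carrier ?G" for g
      using a' that by (auto simp: annihilator_def group_algebra_def)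
    let ?i = "\<lambda>g :: nat \<Rightarrow> nat. if g 1 = 1 then \<zero>\<^bsub>R\<^esub> else \<one>\<^bsub>R\<^esub>"
    \<comment> \<open>\<lambda> commutes with base change: its value on the image of a pure tensor
      is \<open>s\<close> times the image under \<phi> of \<lambda>(a), and \<lambda>(a) vanishes
      over \<open>R\<close>.\<close>
    have "S.moved_sum (s \<odot>\<^bsub>group_algebra S ?G\<^esub> (\<lambda>g\<in>carrier ?G. \<phi> (a g)))
        = (\<Oplus>\<^bsub>S\<^esub>g\<in>carrier ?G. s \<otimes>\<^bsub>S\<^esub> \<phi> (a g \<otimes>\<^bsub>R\<^esub> ?i g))"
      unfolding S.moved_sum_def using s'
      by (intro S.finsum_eqI) (auto simp: group_algebra_def S.m_assoc)
    also have "\<dots> = s \<otimes>\<^bsub>S\<^esub> (\<Oplus>\<^bsub>S\<^esub>g\<in>carrier ?G. (\<phi> \<circ> (\<lambda>g. a g \<otimes>\<^bsub>R\<^esub> ?i g)) g)"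
      using s' by (subst S.finsum_rdistr) (auto simp: comp_def)
    also have "\<dots> = s \<otimes>\<^bsub>S\<^esub> \<phi> (R.moved_sum a)"
      unfolding R.moved_sum_def by (subst hom_finsum) auto
    also have "\<dots> = \<zero>\<^bsub>S\<^esub>"
      using s' R.moved_sum_annihilator[OF assms(4,5) a'] by simp
    finally have "S.moved_sum (?\<beta> (pure_tensor R ?M ?N s a)) = \<zero>\<^bsub>S\<^esub>"
      using s' a \<beta>(2) by simp
    moreover have "?\<beta> (pure_tensor R ?M ?N s a) \<in> carrier ?A"
      using \<beta>(1) pure_tensor_closed[OF s a] by (auto simp: hom_def)
    ultimately show ?thesis by (simp add: kernel_def)
  qed
  assume "annihilator_base_change_property R S \<phi> ?G X \<alpha>"
  then have "?\<beta> ` carrier (tensor_product R ?M ?N) = carrier ?A"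
    by (simp add: annihilator_base_change_property_def iso_def bij_betw_def)
  moreover have "?\<beta> ` carrier (tensor_product R ?M ?N) \<subseteq> ?H"
    by (rule tensor_product_hom_image[OF module_restrict_scalars R.module_Ann_perm \<beta>(1)])
      (intro R.is_cring S.is_cring \<phi> A.a_group m.subgroup_kernel pure; assumption)+
  moreover have "S.klein_element \<in> carrier ?A"
    using S.klein_element_annihilator[OF two] by (simp add: Ann_perm_def)
  ultimately have "S.moved_sum S.klein_element = \<zero>\<^bsub>S\<^esub>" by (auto simp: kernel_def)
  then show False using two one by (simp add: S.moved_sum_klein_element)
qed

section \<open>The Young coset space and the two characteristics\<close>

lemma pair_representation_young:
  assumes "cring S"
  shows "pair_representation S (lcosets\<^bsub>sym_group 4\<^esub> (young_subgroup 2 2))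
    (coset_action (sym_group 4) (young_subgroup 2 2)) (coset_points 2)"
proof (intro pair_representation.intro pair_representation_axioms.intro)
  have 4: "2 + 2 = (4 :: nat)" by simp
  show "permutation_representation S (sym_group 4) (lcosets\<^bsub>sym_group 4\<^esub> (young_subgroup 2 2))
    (coset_action (sym_group 4) (young_subgroup 2 2))"
    using permutation_representation_young[OF assms, of 2 2] unfolding 4 .
  show "bij_betw (coset_points 2) (lcosets\<^bsub>sym_group 4\<^esub> (young_subgroup 2 2)) two_subsets"
    using bij_betw_coset_points[of 2 2] unfolding 4 .
  show "coset_points 2 (coset_action (sym_group 4) (young_subgroup 2 2) g C) = g ` coset_points 2 C"
    if "g \<in> carrier (sym_group 4)" "C \<in> lcosets\<^bsub>sym_group 4\<^esub> (young_subgroup 2 2)" for g C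
    using coset_points_act[of g 2 2 C] that unfolding 4 by blast
qed

lemma ring_char_2:
  assumes "ring R" "ring_char R = 2"
  shows "\<one>\<^bsub>R\<^esub> \<oplus>\<^bsub>R\<^esub> \<one>\<^bsub>R\<^esub> = \<zero>\<^bsub>R\<^esub>"
proof -
  interpret ring R by fact
  let ?P = "\<lambda>n::nat. n > 0 \<and> add_pow R n \<one>\<^bsub>R\<^esub> = \<zero>\<^bsub>R\<^esub>"
  \<comment> \<open>The value 0 encodes that no positive multiple of one vanishes, so the value 2
    must come from the \<open>LEAST\<close> branch.\<close>
  have "\<exists>n. ?P n" "(LEAST n. ?P n) = 2"
    using assms(2) by (auto simp: ring_char_def split: if_splits)
  then have "add_pow R (2::nat) \<one>\<^bsub>R\<^esub> = \<zero>\<^bsub>R\<^esub>" by (metis (mono_tags, lifting) LeastI_ex)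
  then show ?thesis by (simp add: numeral_2_eq_2 add.nat_pow_Suc)
qed

lemma ring_char_0:
  assumes "ring R" "ring_char R = 0"
  shows "\<one>\<^bsub>R\<^esub> \<oplus>\<^bsub>R\<^esub> \<one>\<^bsub>R\<^esub> \<noteq> \<zero>\<^bsub>R\<^esub>"
proof
  interpret ring R by fact
  let ?P = "\<lambda>n::nat. n > 0 \<and> add_pow R n \<one>\<^bsub>R\<^esub> = \<zero>\<^bsub>R\<^esub>"
  assume "\<one>\<^bsub>R\<^esub> \<oplus>\<^bsub>R\<^esub> \<one>\<^bsub>R\<^esub> = \<zero>\<^bsub>R\<^esub>"
  then have "?P 2" by (simp add: numeral_2_eq_2 add.nat_pow_Suc)
  then have ex: "\<exists>n. ?P n" by blast
  then have "?P (LEAST n. ?P n)" by (rule LeastI_ex)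
  then show False using ex assms(2) by (auto simp: ring_char_def split: if_splits)
qed

theorem mainTheorem11:
  fixes R :: "('a, 'm) ring_scheme" and K :: "('k, 'n) ring_scheme" and \<iota> :: "'a \<Rightarrow> 'k"
  assumes "discrete_valuation_ring R"
    and "is_fraction_field R K \<iota>" and "ring_char K = 0"
    and "ring_char (residue_field R) = 2"
  shows "\<not> annihilator_base_change_property R (residue_field R) (residue_map R) (sym_group 4)
             (lcosets\<^bsub>sym_group 4\<^esub> (young_subgroup 2 2))
             (coset_action (sym_group 4) (young_subgroup 2 2))
       \<and> \<not> double_centraliser_property (group_algebra (residue_field R) (sym_group 4))
             (perm_module (residue_field R) (sym_group 4)
                (lcosets\<^bsub>sym_group 4\<^esub> (young_subgroup 2 2))
                (coset_action (sym_group 4) (young_subgroup 2 2)))"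
proof -
  interpret R: discrete_valuation_ring R by fact
  let ?F = "residue_field R"
  interpret F: field ?F using residue_map_ring_hom(2)[OF assms(1)] .
  have K: "field K" and \<iota>: "\<iota> \<in> ring_hom R K"
    using assms(2) by (simp_all add: is_fraction_field_def)
  interpret K: field K by fact
  interpret \<iota>: ring_hom_ring R K \<iota>
    using \<iota> by (simp add: ring_hom_ring_def ring_hom_ring_axioms_def R.ring_axioms K.ring_axioms)
  \<comment> \<open>The characteristic is given for \<open>K\<close>: if 2 vanished in
    \<open>R\<close>, applying \<iota> would make it vanish in \<open>K\<close>.\<close>
  have twoR: "\<one>\<^bsub>R\<^esub> \<oplus>\<^bsub>R\<^esub> \<one>\<^bsub>R\<^esub> \<noteq> \<zero>\<^bsub>R\<^esub>"
    using ring_char_0[OF K.ring_axioms assms(3)]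
    by (metis R.one_closed \<iota>.hom_add \<iota>.hom_one \<iota>.hom_zero)
  have twoF: "\<one>\<^bsub>?F\<^esub> \<oplus>\<^bsub>?F\<^esub> \<one>\<^bsub>?F\<^esub> = \<zero>\<^bsub>?F\<^esub>"
    using ring_char_2[OF F.ring_axioms assms(4)] .
  note pair = pair_representation_young[OF R.is_cring] pair_representation_young[OF F.is_cring]
  show ?thesis
    using not_annihilator_base_change_property[OF pair residue_map_ring_hom(3)[OF assms(1)]
        R.domain_axioms twoR twoF F.one_not_zero]
      pair_representation.not_double_centraliser_property[OF pair(2) twoF F.one_not_zero]
    by blast
qed

end
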